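(* Let $\mathscr B$ be the Wasserstein ambiguity set $\mathscr B=\{\mathbb Q\in\mathscr P(\varXi)\mid d_W(\mathbb Q,\widehat{\mathbb P})\le\theta\}$ with $\widehat{\mathbb P}=\frac1N\sum_{s=1}^N\delta_{\widehat{\boldsymbol\xi}^s}$. Then the objective function $$\min_{\boldsymbol Y_t,\boldsymbol y_t^0,\boldsymbol Z_t,\boldsymbol z_t^0}\ \max_{\mathbb P\in\mathscr B}\mathbb E_{\boldsymbol\xi\sim\mathbb P}\Big[\max_{k\in[K]}\{\boldsymbol d_k^TG(\boldsymbol\xi)+r_k\}\Big]$$ admits the following equivalent reformulation: $$\begin{aligned}\min_{\lambda,\eta^s,\eta^s_{k,t,i},\zeta^s_{k,t,i,j},\boldsymbol Y_t,\boldsymbol y_t^0,\boldsymbol Z_t,\boldsymbol z_t^0}\quad&\lambda\theta+\frac1N\sum_{s=1}^N\eta^s\\ \text{s.t.}\quad&\eta^s\ge\sum_{t=1}^{\mathcal T}\sum_{i=1}^{n_\xi}\eta^s_{k,t,i}+r_k,\\ &\eta^s_{k,t,i}\ge\boldsymbol d_{k,t,i}^T\boldsymbol\varphi^-_{t,i,j}-\zeta^s_{k,t,i,j}\big(\boldsymbol R_{t,i}\boldsymbol\varphi^-_{t,i,j}-\widehat\xi^s_{t,i}\big),\\ &\eta^s_{k,t,i}\ge\boldsymbol d_{k,t,i}^T\boldsymbol\varphi_{t,i,j-1}-\zeta^s_{k,t,i,j}\big(\boldsymbol R_{t,i}\boldsymbol\varphi_{t,i,j-1}-\widehat\xi^s_{t,i}\big),\\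 &|\zeta^s_{k,t,i,j}|\le\lambda,\\ &\forall s\in[N],k\in[K],t\in[\mathcal T],i\in[n_\xi],j\in[p_{t,i}].\end{aligned}$$ That is, for every fixed value of the policy coefficients $(\boldsymbol Y_t,\boldsymbol y_t^0,\boldsymbol Z_t,\boldsymbol z_t^0)_t$, the worst-case expectation equals the optimal value of the displayed minimization over the remaining real variables.
   Context: **Disturbance.** $[N]=\{1,\dots,N\}$. $\boldsymbol\xi=(\xi_{t,i})_{t\in[\mathcal T],i\in[n_\xi]}$ has support the hyperrectangle $\varXi=\prod_{t,i}[l_{t,i},v_{t,i}]$. $\widehat{\boldsymbol\xi}^s\in\varXi$, $s\in[N]$, are data points, with $(t,i)$ component $\widehat\xi^s_{t,i}$, $\delta_{(\cdot)}$ is the Dirac distribution, and $\theta$ is the radius of the ball. $\|\cdot\|$ is the 1-norm. $\mathscr P(\varXi)$ is the set of Borel probability measures on $\varXi$ and $d_W(\mathbb Q,\widehat{\mathbb P})=\inf_\kappa\int_{\varXi\times\varXi}\|\boldsymbol\xi_1-\boldsymbol\xi_2\|\,d\kappa(\boldsymbol\xi_1,\boldsymbol\xi_2)$ over Borel probability measures $\kappa$ on $\varXi\times\varXi$ with marginals $\mathbb Q$ and $\widehat{\mathbb P}$. **Lifting.** For each $(t,i)$ there are an integer $p_{t,i}\ge1$ and breakpoints $l_{t,i}=w_{t,i,0}\le w_{t,i,1}\le\dots\le w_{t,i,p_{t,i}-1}\le w_{t,i,p_{t,i}}=v_{t,i}$. Let $G_{t,i}(\xi_{t,i})=(V_{t,i,1},\dots,V_{t,i,p_{t,i}},Q_{t,i,1},\dots,Q_{t,i,p_{t,i}-1})^T$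 with $V_{t,i,1}=\min\{\xi_{t,i},w_{t,i,1}\}$, $V_{t,i,j}=\max\{\min\{\xi_{t,i},w_{t,i,j}\}-w_{t,i,j-1},0\}$ for $2\le j\le p_{t,i}$, and, for $j\in[p_{t,i}-1]$, $Q_{t,i,j}=0$ if $\xi_{t,i}<w_{t,i,j}$, $Q_{t,i,j}=1$ if $\xi_{t,i}\ge w_{t,i,j}$. $G(\boldsymbol\xi)$ stacks all $G_{t,i}(\xi_{t,i})$ in the order $(1,1),\dots,(1,n_\xi),(2,1),\dots,(\mathcal T,n_\xi)$. $\boldsymbol R_{t,i}$ is the row vector with $\boldsymbol R_{t,i}G_{t,i}(\xi_{t,i})=\sum_jV_{t,i,j}=\xi_{t,i}$ (ones on the $V$-coordinates, zeros on the $Q$-coordinates). $\boldsymbol\varphi_{t,i,j}=G_{t,i}(w_{t,i,j})$ and $\boldsymbol\varphi^-_{t,i,j}=G^-_{t,i}(w_{t,i,j})=\lim_{\xi\nearrow w_{t,i,j}}G_{t,i}(\xi)$ is the left limit. **Objective.** The policy coefficients are $\boldsymbol Y_t\in\mathbb R^{n_u\times n_{V_t}}$, $\boldsymbol y_t^0\in\mathbb R^{n_u}$, $\boldsymbol Z_t\in\mathbb Z^{n_\gamma\times n_{Q_t}}$, $\boldsymbol z_t^0\in\mathbb Z^{n_\gamma}$, $t\in[\mathcal T]$, where $n_{V_t}=\sum_{t'\le t}\sum_ip_{t',i}$, $n_{Q_t}=\sum_{t'\le t}\sum_i(p_{t',i}-1)$. They parametrize the lifted policies $\boldsymbol u_t=\boldsymbol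 Y_t\boldsymbol V_{[t]}+\boldsymbol y_t^0$ and $\boldsymbol\gamma_t=\boldsymbol Z_t\boldsymbol Q_{[t]}+\boldsymbol z_t^0$, where $\boldsymbol V_{[t]},\boldsymbol Q_{[t]}$ stack the $V$'s and $Q$'s up to time $t$. The vectors $\boldsymbol d_k$ and scalars $r_k$, $k\in[K]$, are affine functions of these coefficients, obtained by writing the total cost $\sum_{t=1}^{\mathcal T}\alpha^tc_t(\boldsymbol x_t,\boldsymbol u_t,\boldsymbol\gamma_t)$ with discount factors $\alpha^t\in[0,1]$ and convex piecewise linear costs $c_t=\max_{\tau\in[I]}\{\boldsymbol a_\tau^T\boldsymbol x_t+\boldsymbol b_\tau^T\boldsymbol u_t+\boldsymbol c_\tau^T\boldsymbol\gamma_t\}$ of the linear system $\boldsymbol x_{t+1}=\boldsymbol A_t\boldsymbol x_t+\boldsymbol B_t\boldsymbol u_t+\boldsymbol C_t\boldsymbol\gamma_t+\boldsymbol D_t\boldsymbol\xi_t$ under the lifted policies as $\max_{k\in[K]}\{\boldsymbol d_k^TG(\boldsymbol\xi)+r_k\}$. $\boldsymbol d_k=(\boldsymbol d_{k,1,1}^T,\dots,\boldsymbol d_{k,1,n_\xi}^T,\boldsymbol d_{k,2,1}^T,\dots,\boldsymbol d_{k,\mathcal T,n_\xi}^T)^T$ is the block partition matching $G$.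
   Formalization: The radius θ is taken strictly positive (for θ = 0 the identity can fail when a data point lies on a breakpoint), and the left limit of G at the left endpoint l, relevant when w_1 = l, is taken to be G(l); the max over P is read as a supremum and the outer min as an infimum. *)

theory Defs
  imports "HOL-Probability.Probability" "Jordan_Normal_Form.Matrix"
begin

hide_type (open) Finite_Cartesian_Product.vec
hide_const (open) Finite_Cartesian_Product.vec Finite_Cartesian_Product.mat
no_notation vec_nth (infixl "$" 90)

text \<open>A pair \<open>(t, i)\<close> indexes the disturbance component \<open>i\<close> at time \<open>t\<close>; the lifting
  dimension \<open>p\<close> and the breakpoints \<open>w\<close> are families over such pairs.\<close>

definition disturbance_idx :: "nat \<Rightarrow> nat \<Rightarrow> (nat \<times> nat) set" where
  "disturbance_idx T n = {1..T} \<times> {1..n}"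

text \<open>Concatenation of the blocks \<open>f (1,1), \<dots>, f (1,n), f (2,1), \<dots>, f (T,n)\<close>.\<close>

definition stack :: "nat \<Rightarrow> nat \<Rightarrow> (nat \<times> nat \<Rightarrow> real vec) \<Rightarrow> real vec" where
  "stack T n f = foldr (\<lambda>e acc. f e @\<^sub>v acc) (List.product [1..<Suc T] [1..<Suc n]) (0\<^sub>v 0)"


section \<open>Disturbances and the Wasserstein ball\<close>

text \<open>The underlying set is the hyperrectangle.  As there are finitely many components, the
  product sigma-algebra is its Borel sigma-algebra; likewise for the binary product below.\<close>

definition support_space ::
  "(nat \<times> nat) set \<Rightarrow> (nat \<times> nat \<Rightarrow> real) \<Rightarrow> (nat \<times> nat \<Rightarrow> real) \<Rightarrow> (nat \<times> nat \<Rightarrow> real) measure" where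
  "support_space E l v = (\<Pi>\<^sub>M e\<in>E. restrict_space borel {l e..v e})"

definition dist1 :: "(nat \<times> nat) set \<Rightarrow> (nat \<times> nat \<Rightarrow> real) \<Rightarrow> (nat \<times> nat \<Rightarrow> real) \<Rightarrow> real" where
  "dist1 E x y = (\<Sum>e\<in>E. \<bar>x e - y e\<bar>)"

definition prob_measures :: "'a measure \<Rightarrow> 'a measure set" where
  "prob_measures M = {Q. prob_space Q \<and> sets Q = sets M}"

definition couplings :: "'a measure \<Rightarrow> 'a measure \<Rightarrow> 'a measure \<Rightarrow> ('a \<times> 'a) measure set" where
  "couplings M P Q =
     {\<kappa> \<in> prob_measures (M \<Otimes>\<^sub>M M). distr \<kappa> M fst = P \<and> distr \<kappa> M snd = Q}"

definition wasserstein :: "'a measure \<Rightarrow> ('a \<Rightarrow> 'a \<Rightarrow> real) \<Rightarrow> 'a measure \<Rightarrow> 'a measure \<Rightarrow> ennreal" where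
  "wasserstein M dst P Q =
     (INF \<kappa>\<in>couplings M P Q. \<integral>\<^sup>+ z. ennreal (dst (fst z) (snd z)) \<partial>\<kappa>)"

definition wasserstein_ball ::
  "'a measure \<Rightarrow> ('a \<Rightarrow> 'a \<Rightarrow> real) \<Rightarrow> 'a measure \<Rightarrow> real \<Rightarrow> 'a measure set" where
  "wasserstein_ball M dst P \<theta> = {Q \<in> prob_measures M. wasserstein M dst Q P \<le> ennreal \<theta>}"

definition empirical :: "'a measure \<Rightarrow> nat \<Rightarrow> (nat \<Rightarrow> 'a) \<Rightarrow> 'a measure" where
  "empirical M N xs = measure_of (space M) (sets M)
     (\<lambda>A. (\<Sum>s\<in>{1..N}. emeasure (return M (xs s)) A) / of_nat N)"

lemma sets_empirical [simp]: "sets (empirical M N xs) = sets M"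
  by (simp add: empirical_def)

lemma space_empirical [simp]: "space (empirical M N xs) = space M"
  by (simp add: empirical_def)

lemma emeasure_empirical:
  assumes "A \<in> sets M"
  shows "emeasure (empirical M N xs) A = (\<Sum>s\<in>{1..N}. emeasure (return M (xs s)) A) / of_nat N"
proof -
  let ?f = "\<lambda>A. (\<Sum>s\<in>{1..N}. emeasure (return M (xs s)) A) / of_nat N"
  have "countably_additive (sets M) ?f"
  proof (rule countably_additiveI)
    fix B :: "nat \<Rightarrow> _"
    assume B: "range B \<subseteq> sets M" "disjoint_family B" "\<Union> (range B) \<in> sets M"
    have "(\<Sum>j. ?f (B j)) = (\<Sum>j. \<Sum>s\<in>{1..N}. emeasure (return M (xs s)) (B j)) / of_nat N"
      by (simp add: divide_ennreal_def)
    also have "(\<Sum>j. \<Sum>s\<in>{1..N}. emeasure (return M (xs s)) (B j))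
        = (\<Sum>s\<in>{1..N}. \<Sum>j. emeasure (return M (xs s)) (B j))"
      by (rule suminf_sum) simp
    also have "\<dots> = (\<Sum>s\<in>{1..N}. emeasure (return M (xs s)) (\<Union> (range B)))"
      by (intro sum.cong refl suminf_emeasure) (use B in auto)
    finally show "(\<Sum>j. ?f (B j)) = ?f (\<Union> (range B))" .
  qed
  moreover have "positive (sets M) ?f"
    by (simp add: positive_def)
  ultimately show ?thesis
    using assms by (intro emeasure_measure_of[OF empirical_def]) (auto simp: sets.space_closed)
qed


section \<open>Lifting\<close>

definition lift_V :: "(nat \<Rightarrow> real) \<Rightarrow> nat \<Rightarrow> real \<Rightarrow> real" where
  "lift_V w j x = (if j = 1 then min x (w 1) else max (min x (w j) - w (j - 1)) 0)"

definition lift_Q :: "(nat \<Rightarrow> real) \<Rightarrow> nat \<Rightarrow> real \<Rightarrow> real" where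
  "lift_Q w j x = (if x < w j then 0 else 1)"

definition vec_V :: "nat \<Rightarrow> (nat \<Rightarrow> real) \<Rightarrow> real \<Rightarrow> real vec" where
  "vec_V p w x = vec p (\<lambda>m. lift_V w (Suc m) x)"

definition vec_Q :: "nat \<Rightarrow> (nat \<Rightarrow> real) \<Rightarrow> real \<Rightarrow> real vec" where
  "vec_Q p w x = vec (p - 1) (\<lambda>m. lift_Q w (Suc m) x)"

definition lift_G :: "nat \<Rightarrow> (nat \<Rightarrow> real) \<Rightarrow> real \<Rightarrow> real vec" where
  "lift_G p w x = vec_V p w x @\<^sub>v vec_Q p w x"

definition retract_R :: "nat \<Rightarrow> real vec" where
  "retract_R p = vec p (\<lambda>_. 1) @\<^sub>v 0\<^sub>v (p - 1)"

text \<open>The left limit is taken componentwise.  \<open>lift_G p w\<close> is a lifting of the interval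
  \<open>[w 0, w p]\<close>, which has no points to the left of \<open>w 0\<close>; there the usual convention
  for functions on an interval applies, namely that the left limit is the value itself.  This
  concerns only inputs with \<open>w 1 = w 0\<close>, and differs from the limit of the formulas extended
  to the real line only if moreover \<open>p \<ge> 2\<close>.\<close>

definition lift_G_left :: "nat \<Rightarrow> (nat \<Rightarrow> real) \<Rightarrow> real \<Rightarrow> real vec" where
  "lift_G_left p w x =
     (if x = w 0 then lift_G p w x
      else vec (p + (p - 1)) (\<lambda>m. Lim (at_left x) (\<lambda>y. lift_G p w y $ m)))"

lemma lift_G_left_tendsto:
  assumes "x \<noteq> w 0" "m < p + (p - 1)"
  shows "((\<lambda>y. lift_G p w y $ m) \<longlongrightarrow> lift_G_left p w x $ m) (at_left x)"
proof -
  have V: "((\<lambda>y. lift_V w j y) \<longlongrightarrow> lift_V w j x) (at_left x)" for j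
    unfolding lift_V_def by (cases "j = 1") (simp_all, (intro tendsto_intros)+)
  have Q: "\<exists>L. ((\<lambda>y. lift_Q w j y) \<longlongrightarrow> L) (at_left x)" for j
  proof (cases "x \<le> w j")
    case True
    have "\<forall>\<^sub>F y in at_left x. lift_Q w j y = 0"
      using True by (auto simp: lift_Q_def eventually_at_left_field intro!: exI[of _ "x - 1"])
    then show ?thesis by (blast intro: tendsto_eventually)
  next
    case False
    then have "\<forall>\<^sub>F y in at_left x. lift_Q w j y = 1"
      by (auto simp: lift_Q_def eventually_at_left_field intro!: exI[of _ "w j"])
    then show ?thesis by (blast intro: tendsto_eventually)
  qed
  have "\<exists>L. ((\<lambda>y. lift_G p w y $ m) \<longlongrightarrow> L) (at_left x)"
    using V[of "Suc m"] Q[of "Suc (m - p)"] assms(2)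
    by (cases "m < p") (auto simp: lift_G_def vec_V_def vec_Q_def)
  then show ?thesis
    using assms tendsto_Lim[of "at_left x"] by (auto simp: lift_G_left_def)
qed

definition lift_all ::
  "nat \<Rightarrow> nat \<Rightarrow> (nat \<times> nat \<Rightarrow> nat) \<Rightarrow> (nat \<times> nat \<Rightarrow> nat \<Rightarrow> real) \<Rightarrow> (nat \<times> nat \<Rightarrow> real) \<Rightarrow> real vec" where
  "lift_all T n p w \<xi> = stack T n (\<lambda>e. lift_G (p e) (w e) (\<xi> e))"

definition dim_V :: "nat \<Rightarrow> (nat \<times> nat \<Rightarrow> nat) \<Rightarrow> nat \<Rightarrow> nat" where
  "dim_V n p t = (\<Sum>e\<in>disturbance_idx t n. p e)"

definition dim_Q :: "nat \<Rightarrow> (nat \<times> nat \<Rightarrow> nat) \<Rightarrow> nat \<Rightarrow> nat" where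
  "dim_Q n p t = (\<Sum>e\<in>disturbance_idx t n. p e - 1)"


section \<open>Control problem and lifted policies\<close>

record control_problem =
  dim_x :: nat
  dim_u :: nat
  dim_g :: nat
  sys_A :: "nat \<Rightarrow> real mat"
  sys_B :: "nat \<Rightarrow> real mat"
  sys_C :: "nat \<Rightarrow> real mat"
  sys_D :: "nat \<Rightarrow> real mat"
  x_init :: "real vec"
  discount :: "nat \<Rightarrow> real"
  num_pieces :: nat
  cost_a :: "nat \<Rightarrow> real vec"
  cost_b :: "nat \<Rightarrow> real vec"
  cost_c :: "nat \<Rightarrow> real vec"

definition control_problem_ok :: "nat \<Rightarrow> nat \<Rightarrow> control_problem \<Rightarrow> bool" where
  "control_problem_ok T n S \<longleftrightarrow>
     (\<forall>t\<in>{1..T}.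
        sys_A S t \<in> carrier_mat (dim_x S) (dim_x S) \<and>
        sys_B S t \<in> carrier_mat (dim_x S) (dim_u S) \<and>
        sys_C S t \<in> carrier_mat (dim_x S) (dim_g S) \<and>
        sys_D S t \<in> carrier_mat (dim_x S) n \<and>
        0 \<le> discount S t \<and> discount S t \<le> 1) \<and>
     x_init S \<in> carrier_vec (dim_x S) \<and>
     1 \<le> num_pieces S \<and>
     (\<forall>\<tau>\<in>{1..num_pieces S}.
        cost_a S \<tau> \<in> carrier_vec (dim_x S) \<and>
        cost_b S \<tau> \<in> carrier_vec (dim_u S) \<and>
        cost_c S \<tau> \<in> carrier_vec (dim_g S))"

definition stage_cost :: "control_problem \<Rightarrow> real vec \<Rightarrow> real vec \<Rightarrow> real vec \<Rightarrow> real" where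
  "stage_cost S x u g =
     (MAX \<tau>\<in>{1..num_pieces S}. cost_a S \<tau> \<bullet> x + cost_b S \<tau> \<bullet> u + cost_c S \<tau> \<bullet> g)"

record policy =
  coef_Y :: "nat \<Rightarrow> real mat"
  coef_y0 :: "nat \<Rightarrow> real vec"
  coef_Z :: "nat \<Rightarrow> int mat"
  coef_z0 :: "nat \<Rightarrow> int vec"

definition policies ::
  "nat \<Rightarrow> nat \<Rightarrow> (nat \<times> nat \<Rightarrow> nat) \<Rightarrow> control_problem \<Rightarrow> policy set" where
  "policies T n p S = {\<pi>. \<forall>t\<in>{1..T}.
     coef_Y \<pi> t \<in> carrier_mat (dim_u S) (dim_V n p t) \<and>
     coef_y0 \<pi> t \<in> carrier_vec (dim_u S) \<and>
     coef_Z \<pi> t \<in> carrier_mat (dim_g S) (dim_Q n p t) \<and>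
     coef_z0 \<pi> t \<in> carrier_vec (dim_g S)}"

definition policy_u ::
  "nat \<Rightarrow> (nat \<times> nat \<Rightarrow> nat) \<Rightarrow> (nat \<times> nat \<Rightarrow> nat \<Rightarrow> real) \<Rightarrow> policy \<Rightarrow>
   (nat \<times> nat \<Rightarrow> real) \<Rightarrow> nat \<Rightarrow> real vec" where
  "policy_u n p w \<pi> \<xi> t =
     coef_Y \<pi> t *\<^sub>v stack t n (\<lambda>e. vec_V (p e) (w e) (\<xi> e)) + coef_y0 \<pi> t"

definition policy_g ::
  "nat \<Rightarrow> (nat \<times> nat \<Rightarrow> nat) \<Rightarrow> (nat \<times> nat \<Rightarrow> nat \<Rightarrow> real) \<Rightarrow> policy \<Rightarrow>
   (nat \<times> nat \<Rightarrow> real) \<Rightarrow> nat \<Rightarrow> real vec" where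
  "policy_g n p w \<pi> \<xi> t =
     map_mat real_of_int (coef_Z \<pi> t) *\<^sub>v stack t n (\<lambda>e. vec_Q (p e) (w e) (\<xi> e))
       + map_vec real_of_int (coef_z0 \<pi> t)"

text \<open>\<open>state \<dots> m\<close> is the state at time \<open>m + 1\<close>; the initial state at time 1 is given.\<close>

primrec state ::
  "control_problem \<Rightarrow> nat \<Rightarrow> (nat \<Rightarrow> real vec) \<Rightarrow> (nat \<Rightarrow> real vec) \<Rightarrow>
   (nat \<times> nat \<Rightarrow> real) \<Rightarrow> nat \<Rightarrow> real vec" where
  "state S n u g \<xi> 0 = x_init S"
| "state S n u g \<xi> (Suc m) =
     sys_A S (Suc m) *\<^sub>v state S n u g \<xi> m + sys_B S (Suc m) *\<^sub>v u (Suc m)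
       + sys_C S (Suc m) *\<^sub>v g (Suc m) + sys_D S (Suc m) *\<^sub>v vec n (\<lambda>i. \<xi> (Suc m, Suc i))"

definition total_cost ::
  "nat \<Rightarrow> nat \<Rightarrow> (nat \<times> nat \<Rightarrow> nat) \<Rightarrow> (nat \<times> nat \<Rightarrow> nat \<Rightarrow> real) \<Rightarrow> control_problem \<Rightarrow>
   policy \<Rightarrow> (nat \<times> nat \<Rightarrow> real) \<Rightarrow> real" where
  "total_cost T n p w S \<pi> \<xi> =
     (let u = policy_u n p w \<pi> \<xi>; g = policy_g n p w \<pi> \<xi>
      in \<Sum>t\<in>{1..T}. discount S t * stage_cost S (state S n u g \<xi> (t - 1)) (u t) (g t))"

text \<open>The restriction to the policies of an affine function of all real coefficients.\<close>

definition policy_affine ::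
  "nat \<Rightarrow> nat \<Rightarrow> (nat \<times> nat \<Rightarrow> nat) \<Rightarrow> control_problem \<Rightarrow> (policy \<Rightarrow> real) \<Rightarrow> bool" where
  "policy_affine T n p S f \<longleftrightarrow>
     (\<exists>(c::real) (cY :: nat \<Rightarrow> nat \<Rightarrow> nat \<Rightarrow> real) (cy :: nat \<Rightarrow> nat \<Rightarrow> real)
        (cZ :: nat \<Rightarrow> nat \<Rightarrow> nat \<Rightarrow> real) (cz :: nat \<Rightarrow> nat \<Rightarrow> real).
      \<forall>\<pi>\<in>policies T n p S.
        f \<pi> = c + (\<Sum>t\<in>{1..T}.
          (\<Sum>a<dim_u S. (\<Sum>b<dim_V n p t. cY t a b * coef_Y \<pi> t $$ (a, b))
             + cy t a * coef_y0 \<pi> t $ a)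
          + (\<Sum>a<dim_g S. (\<Sum>b<dim_Q n p t. cZ t a b * real_of_int (coef_Z \<pi> t $$ (a, b)))
             + cz t a * real_of_int (coef_z0 \<pi> t $ a))))"


section \<open>The reformulation\<close>

text \<open>The constraints for fixed policy coefficients; \<open>d k (t, i)\<close> is the block of
  the stacked vector \<open>d k\<close> belonging to \<open>(t, i)\<close>.\<close>

definition reformulation_feasible ::
  "nat \<Rightarrow> nat \<Rightarrow> nat \<Rightarrow> nat \<Rightarrow> (nat \<times> nat \<Rightarrow> nat) \<Rightarrow> (nat \<times> nat \<Rightarrow> nat \<Rightarrow> real) \<Rightarrow>
   (nat \<Rightarrow> nat \<times> nat \<Rightarrow> real) \<Rightarrow> (nat \<Rightarrow> nat \<times> nat \<Rightarrow> real vec) \<Rightarrow> (nat \<Rightarrow> real) \<Rightarrow>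
   real \<Rightarrow> (nat \<Rightarrow> real) \<Rightarrow> (nat \<Rightarrow> nat \<Rightarrow> nat \<times> nat \<Rightarrow> real) \<Rightarrow>
   (nat \<Rightarrow> nat \<Rightarrow> nat \<times> nat \<Rightarrow> nat \<Rightarrow> real) \<Rightarrow> bool" where
  "reformulation_feasible T n N K p w \<xi>hat d r lam \<eta> \<eta>b \<zeta> \<longleftrightarrow>
     (\<forall>s\<in>{1..N}. \<forall>k\<in>{1..K}.
        \<eta> s \<ge> (\<Sum>t\<in>{1..T}. \<Sum>i\<in>{1..n}. \<eta>b s k (t, i)) + r k \<and>
        (\<forall>e\<in>disturbance_idx T n. \<forall>j\<in>{1..p e}.
           \<eta>b s k e \<ge> d k e \<bullet> lift_G_left (p e) (w e) (w e j)
             - \<zeta> s k e j * (retract_R (p e) \<bullet> lift_G_left (p e) (w e) (w e j) - \<xi>hat s e) \<and>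
           \<eta>b s k e \<ge> d k e \<bullet> lift_G (p e) (w e) (w e (j - 1))
             - \<zeta> s k e j * (retract_R (p e) \<bullet> lift_G (p e) (w e) (w e (j - 1)) - \<xi>hat s e) \<and>
           \<bar>\<zeta> s k e j\<bar> \<le> lam))"

definition reformulation_objective :: "nat \<Rightarrow> real \<Rightarrow> real \<Rightarrow> (nat \<Rightarrow> real) \<Rightarrow> real" where
  "reformulation_objective N \<theta> lam \<eta> = lam * \<theta> + 1 / real N * (\<Sum>s\<in>{1..N}. \<eta> s)"

end

theory Submission
  imports Defs
begin

text \<open>Fix the policy, and write \<open>f\<close> for the resulting cost, a maximum of functions that separate
  over the disturbance components.  The proof has two independent halves.

  The first half is Wasserstein duality: the worst case over the ball equals
  \<open>lam * \<theta> + (1/N) * (\<Sum>s. sup\<^sub>x (f x - lam * dist x (\<xi>hat s)))\<close> for some \<open>lam \<ge> 0\<close>, and is at most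
  this for every \<open>lam \<ge> 0\<close>.  The bound comes from integrating \<open>f x \<le> h y + lam * dist x y\<close> against
  couplings (\<open>integral_le_dual\<close>).  For equality, every way of moving the \<open>N\<close> atoms gives a planar
  point (mean cost, mean value), mixtures of two such moves are admissible adversaries
  (\<open>mixture_in_ball\<close>), and the required multiplier is the slope of a line that supports these points
  at cost \<open>\<theta>\<close> (\<open>supporting_slope\<close>, \<open>exists_dual_multiplier\<close>).  Since \<open>f\<close> may jump at
  breakpoints, a worst-case measure need not exist; planar convexity avoids any compactness or
  semicontinuity, and \<open>0 < \<theta>\<close> makes the multiplier exist.

  The second half evaluates the suprema.  For fixed \<open>k\<close> the penalized cost separates over the
  components, so its supremum is a sum of one-dimensional suprema (\<open>sum_SUP_le\<close>).  In one
  dimension the lifted cost is affine on each piece between breakpoints, and on each piece the penalty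
  \<open>lam * \<bar>x - \<xi>\<bar>\<close> may be replaced by a linear one \<open>\<zeta> * (x - \<xi>)\<close> with \<open>\<bar>\<zeta>\<bar> \<le> lam\<close> without
  changing the supremum (\<open>exists_piece_multiplier\<close>, \<open>penalized_le_of_piece_multipliers\<close>).  An affine
  function on a piece is bounded by its two end values, and these are the two constraint families.\<close>

section \<open>Supporting lines and separable suprema\<close>

text \<open>The supporting line at \<open>\<theta>\<close> of the concave envelope of a planar set of points
  \<open>(a i, b i)\<close>, where only chords across \<open>\<theta>\<close> are known to stay below \<open>v\<close>.
  The slope is the supremum of zero and the slopes from \<open>(\<theta>, v)\<close> to points on the right;
  the chord bound says that this is at most every slope from a point on the left.
  A point strictly on the left is what keeps the slope finite.\<close>

lemma supporting_slope:
  fixes b :: "'i \<Rightarrow> real" and a :: "'i \<Rightarrow> real" and v \<theta> :: real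
  assumes below: "i0 \<in> I" "a i0 < \<theta>"
    and cap: "\<And>i. i \<in> I \<Longrightarrow> a i \<le> \<theta> \<Longrightarrow> b i \<le> v"
    and chord: "\<And>i j. i \<in> I \<Longrightarrow> j \<in> I \<Longrightarrow> a i < \<theta> \<Longrightarrow> \<theta> < a j \<Longrightarrow>
        (a j - \<theta>) / (a j - a i) * b i + (\<theta> - a i) / (a j - a i) * b j \<le> v"
  shows "\<exists>lam\<ge>0. \<forall>i\<in>I. b i \<le> v + lam * (a i - \<theta>)"
proof -
  define R where "R = insert 0 ((\<lambda>j. (b j - v) / (a j - \<theta>)) ` {j\<in>I. \<theta> < a j})"
  define lam where "lam = Sup R"
  have le: "x \<le> (v - b i) / (\<theta> - a i)" if "x \<in> R" and i: "i \<in> I" "a i < \<theta>" for x i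
  proof -
    consider "x = 0" | j where "j \<in> I" "\<theta> < a j" "x = (b j - v) / (a j - \<theta>)"
      using \<open>x \<in> R\<close> unfolding R_def by auto
    then show ?thesis
    proof cases
      case 1
      then show ?thesis using i cap[of i] by simp
    next
      case 2
      have pos: "0 < a j - a i" "0 < a j - \<theta>" "0 < \<theta> - a i" using 2 i by auto
      have "(a j - \<theta>) * b i + (\<theta> - a i) * b j \<le> v * (a j - a i)"
        using chord[OF i(1) 2(1) i(2) 2(2)] pos
        by (simp add: add_divide_distrib[symmetric] divide_le_eq)
      then have "(b j - v) * (\<theta> - a i) \<le> (v - b i) * (a j - \<theta>)"
        by (simp add: algebra_simps)
      then show ?thesis
        using pos 2 by (simp add: divide_le_eq le_divide_eq mult.commute)
    qed
  qed
  have bdd: "bdd_above R"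
    using le below by (meson bdd_aboveI)
  have "0 \<le> lam" unfolding lam_def
    using bdd by (intro cSup_upper) (auto simp: R_def)
  moreover have "b i \<le> v + lam * (a i - \<theta>)" if i: "i \<in> I" for i
  proof (cases "a i" \<theta> rule: linorder_cases)
    case less
    have "lam \<le> (v - b i) / (\<theta> - a i)"
      unfolding lam_def using le i less by (intro cSup_least) (auto simp: R_def)
    then have "lam * (\<theta> - a i) \<le> v - b i" using less by (simp add: le_divide_eq)
    then show ?thesis by (simp add: algebra_simps)
  next
    case equal
    then show ?thesis using cap[of i] i by simp
  next
    case greater
    have "(b i - v) / (a i - \<theta>) \<le> lam"
      unfolding lam_def using bdd i greater by (intro cSup_upper) (auto simp: R_def)
    then show ?thesis using greater by (simp add: divide_le_eq algebra_simps)
  qed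
  ultimately show ?thesis by blast
qed

text \<open>In a product set all coordinates can be made nearly optimal at the same time.  This is used
  twice: with one coordinate for each data point, and with one for each disturbance component.\<close>

lemma sum_SUP_le:
  fixes \<phi> :: "'i \<Rightarrow> 'a \<Rightarrow> real"
  assumes fin: "finite E" and ne: "\<And>e. e \<in> E \<Longrightarrow> X e \<noteq> {}"
    and C: "\<And>x. x \<in> Pi\<^sub>E E X \<Longrightarrow> (\<Sum>e\<in>E. \<phi> e (x e)) \<le> C"
  shows "(\<Sum>e\<in>E. SUP y\<in>X e. \<phi> e y) \<le> C"
proof (rule field_le_epsilon)
  fix \<epsilon> :: real assume "0 < \<epsilon>"
  define \<delta> where "\<delta> = \<epsilon> / (real (card E) + 1)"
  have \<delta>: "0 < \<delta>" "real (card E) * \<delta> \<le> \<epsilon>"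
    using \<open>0 < \<epsilon>\<close> by (auto simp: \<delta>_def field_simps)
  have "\<exists>y\<in>X e. (SUP y\<in>X e. \<phi> e y) - \<delta> < \<phi> e y" if "e \<in> E" for e
    using less_cSupD[of "\<phi> e ` X e" "(SUP y\<in>X e. \<phi> e y) - \<delta>"] ne[OF that] \<delta> by auto
  then obtain y where y: "\<And>e. e \<in> E \<Longrightarrow> y e \<in> X e \<and> (SUP y\<in>X e. \<phi> e y) - \<delta> < \<phi> e (y e)"
    by metis
  have "(\<Sum>e\<in>E. SUP y\<in>X e. \<phi> e y) \<le> (\<Sum>e\<in>E. \<phi> e (restrict y E e) + \<delta>)"
    using y by (intro sum_mono) fastforce
  also have "\<dots> \<le> C + \<epsilon>"
    using C[of "restrict y E"] y \<delta> by (auto simp: sum.distrib)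
  finally show "(\<Sum>e\<in>E. SUP y\<in>X e. \<phi> e y) \<le> C + \<epsilon>" .
qed

section \<open>Wasserstein duality for an empirical measure\<close>

text \<open>Realizing the empirical measure as the image of a uniformly drawn index makes integrals and
  couplings with it finite sums over the indices.\<close>

lemma empirical_eq_distr_pmf:
  assumes "1 \<le> N" "\<And>s. xs s \<in> space M"
  shows "empirical M N xs = distr (measure_pmf (pmf_of_set {1..N})) M xs"
proof (rule measure_eqI)
  fix A assume "A \<in> sets (empirical M N xs)"
  then have A: "A \<in> sets M" by simp
  have "emeasure (distr (measure_pmf (pmf_of_set {1..N})) M xs) A
      = emeasure (measure_pmf (pmf_of_set {1..N})) (xs -` A)"
    using A assms by (subst emeasure_distr) auto
  also have "\<dots> = ennreal (real (card ({1..N} \<inter> xs -` A)) / real N)"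
    using assms(1) by (subst emeasure_pmf_of_set) auto
  also have "\<dots> = of_nat (card ({1..N} \<inter> xs -` A)) / of_nat N"
    using assms(1) by (simp add: divide_ennreal[symmetric] ennreal_of_nat_eq_real_of_nat)
  also have "of_nat (card ({1..N} \<inter> xs -` A)) = (\<Sum>s\<in>{1..N}. emeasure (return M (xs s)) A)"
    using A by (simp add: indicator_def sum.If_cases vimage_def)
  finally show "emeasure (empirical M N xs) A
      = emeasure (distr (measure_pmf (pmf_of_set {1..N})) M xs) A"
    using A by (simp add: emeasure_empirical)
qed simp

text \<open>The reference measure has finitely many atoms, so it is enough to follow where each atom
  is moved; \<open>f\<close> enters only as a bounded measurable function, so a lifted cost may jump.\<close>

locale empirical_transport =
  fixes M :: "'a measure" and dst :: "'a \<Rightarrow> 'a \<Rightarrow> real" and N :: nat and xs :: "nat \<Rightarrow> 'a"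
    and f :: "'a \<Rightarrow> real" and B :: real
  assumes N: "1 \<le> N"
    and atom: "\<And>s. s \<in> {1..N} \<Longrightarrow> xs s \<in> space M"
    and atom_sets: "\<And>s. s \<in> {1..N} \<Longrightarrow> {xs s} \<in> sets M"
    and dst_measurable: "(\<lambda>z. dst (fst z) (snd z)) \<in> borel_measurable (M \<Otimes>\<^sub>M M)"
    and dst_nonneg: "\<And>x y. 0 \<le> dst x y"
    and dst_self: "\<And>x. dst x x = 0"
    and f_measurable: "f \<in> borel_measurable M"
    and f_bound: "\<And>x. x \<in> space M \<Longrightarrow> \<bar>f x\<bar> \<le> B"
begin

abbreviation W_ball where "W_ball \<theta> \<equiv> wasserstein_ball M dst (empirical M N xs) \<theta>"

definition avg :: "(nat \<Rightarrow> real) \<Rightarrow> real" where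
  "avg g = 1 / real N * (\<Sum>s\<in>{1..N}. g s)"

lemma avg_cong: "(\<And>s. s \<in> {1..N} \<Longrightarrow> g s = g' s) \<Longrightarrow> avg g = avg g'"
  unfolding avg_def by (intro arg_cong2[where f = "(*)"] sum.cong) auto

lemma empirical_eq_distr:
  "empirical M N xs = distr (measure_pmf (pmf_of_set {1..N})) M (\<lambda>s. if s \<in> {1..N} then xs s else xs 1)"
proof -
  have "empirical M N xs = empirical M N (\<lambda>s. if s \<in> {1..N} then xs s else xs 1)"
    unfolding empirical_def
    by (intro arg_cong[where f = "measure_of _ _"] ext arg_cong2[where f = "(/)"] sum.cong) auto
  then show ?thesis
    using N atom by (subst (asm) (2) empirical_eq_distr_pmf) auto
qed

lemma integral_empirical:
  fixes h :: "'a \<Rightarrow> real"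
  assumes "h \<in> borel_measurable M"
  shows "(\<integral>y. h y \<partial>empirical M N xs) = avg (\<lambda>s. h (xs s))"
proof -
  have "(\<integral>y. h y \<partial>empirical M N xs)
      = (\<integral>s. h (if s \<in> {1..N} then xs s else xs 1) \<partial>measure_pmf (pmf_of_set {1..N}))"
    unfolding empirical_eq_distr using N atom assms by (intro integral_distr) auto
  also have "\<dots> = avg (\<lambda>s. h (xs s))"
    using N by (subst integral_pmf_of_set) (auto simp: avg_def)
  finally show ?thesis .
qed

text \<open>Weak duality.  Along a coupling with cost at most \<open>\<theta> + \<delta>\<close>, the value of \<open>f\<close> at the
  first point is bounded by a function of the second point plus \<open>lam\<close> times the distance.  The
  infimum over couplings need not be attained a priori, which is why \<open>\<delta>\<close> appears.\<close>

lemma integral_le_dual: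
  assumes \<theta>: "0 \<le> \<theta>" and lam: "0 \<le> lam"
    and \<eta>: "\<And>s x. s \<in> {1..N} \<Longrightarrow> x \<in> space M \<Longrightarrow> f x - lam * dst x (xs s) \<le> \<eta> s"
    and Q: "Q \<in> W_ball \<theta>"
  shows "(\<integral>x. f x \<partial>Q) \<le> lam * \<theta> + avg \<eta>"
proof (rule field_le_epsilon)
  fix \<epsilon> :: real assume "0 < \<epsilon>"
  define \<delta> where "\<delta> = \<epsilon> / (lam + 1)"
  have \<delta>: "0 < \<delta>" "lam * \<delta> \<le> \<epsilon>"
    using \<open>0 < \<epsilon>\<close> lam by (auto simp: \<delta>_def field_simps)
  have "wasserstein M dst Q (empirical M N xs) < ennreal (\<theta> + \<delta>)"
    using Q \<delta> \<theta> unfolding wasserstein_ball_def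
    by (auto intro: le_less_trans simp: ennreal_less_iff)
  then obtain \<kappa> where \<kappa>: "\<kappa> \<in> couplings M Q (empirical M N xs)"
    and cost: "(\<integral>\<^sup>+ z. ennreal (dst (fst z) (snd z)) \<partial>\<kappa>) < ennreal (\<theta> + \<delta>)"
    unfolding wasserstein_def INF_less_iff by blast
  from \<kappa> have sets_\<kappa> [measurable_cong]: "sets \<kappa> = sets (M \<Otimes>\<^sub>M M)"
    and marg: "distr \<kappa> M fst = Q" "distr \<kappa> M snd = empirical M N xs"
    by (auto simp: couplings_def prob_measures_def)
  interpret \<kappa>: prob_space \<kappa>
    using \<kappa> by (auto simp: couplings_def prob_measures_def)
  note f_measurable [measurable] dst_measurable [measurable]
  have space_\<kappa>: "space \<kappa> = space M \<times> space M"
    using sets_eq_imp_space_eq[OF sets_\<kappa>] by (simp add: space_pair_measure)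
  have dst_int: "integrable \<kappa> (\<lambda>z. dst (fst z) (snd z))"
    using cost dst_nonneg by (intro integrableI_nonneg) (auto intro: less_trans ennreal_less_top)
  have dst_le: "(\<integral>z. dst (fst z) (snd z) \<partial>\<kappa>) \<le> \<theta> + \<delta>"
  proof -
    have "ennreal (\<integral>z. dst (fst z) (snd z) \<partial>\<kappa>) \<le> ennreal (\<theta> + \<delta>)"
      using cost dst_nonneg by (subst nn_integral_eq_integral[OF dst_int, symmetric]) auto
    then show ?thesis using \<theta> \<delta> by (subst (asm) ennreal_le_iff) auto
  qed
  \<comment> \<open>\<open>h\<close> majorizes \<open>f x - lam * dst x y\<close> for every \<open>y\<close>.  Off the atoms it is the constant bound
    of \<open>f\<close>, which makes it measurable and avoids null sets; the minimum handles data points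
    that coincide.\<close>
  define h where "h y = Min ((\<lambda>s. if y = xs s then \<eta> s else B) ` {1..N})" for y
  have h_meas [measurable]: "h \<in> borel_measurable M"
  proof -
    have "(\<lambda>y. if y = xs s then \<eta> s else B) \<in> borel_measurable M" if "s \<in> {1..N}" for s
      using measurable_If_set[of "\<lambda>_. \<eta> s" M borel "\<lambda>_. B" "{xs s}"] atom_sets[OF that]
      by (simp add: sets.Int)
    then show ?thesis
      unfolding h_def by (intro borel_measurable_Min) auto
  qed
  have h_ge: "f x - lam * dst x y \<le> h y" if "x \<in> space M" for x y
  proof -
    have "f x - lam * dst x y \<le> (if y = xs s then \<eta> s else B)" if "s \<in> {1..N}" for s
      using \<eta>[OF that \<open>x \<in> space M\<close>] f_bound[OF \<open>x \<in> space M\<close>]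
        mult_nonneg_nonneg[OF lam dst_nonneg[of x y]] by auto
    then show ?thesis
      unfolding h_def using N by (intro Min.boundedI) (fastforce intro: imageE)+
  qed
  have h_bound: "\<bar>h y\<bar> \<le> \<bar>B\<bar> + (\<Sum>s\<in>{1..N}. \<bar>\<eta> s\<bar>)" for y
  proof -
    have "h y \<in> (\<lambda>s. if y = xs s then \<eta> s else B) ` {1..N}"
      unfolding h_def by (rule Min_in) (simp, use N in \<open>simp only: image_is_empty, simp\<close>)
    then obtain s where "s \<in> {1..N}" "h y = \<eta> s \<or> h y = B" by (auto split: if_splits)
    moreover have "\<bar>\<eta> s\<bar> \<le> (\<Sum>s\<in>{1..N}. \<bar>\<eta> s\<bar>)"
      using \<open>s \<in> {1..N}\<close> by (intro member_le_sum) auto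
    moreover have "0 \<le> (\<Sum>s\<in>{1..N}. \<bar>\<eta> s\<bar>)" by (intro sum_nonneg) auto
    ultimately show ?thesis by linarith
  qed
  have h_int: "integrable \<kappa> (\<lambda>z. h (snd z))"
    using h_bound by (intro \<kappa>.integrable_const_bound) auto
  have "(\<integral>x. f x \<partial>Q) = (\<integral>z. f (fst z) \<partial>\<kappa>)"
    unfolding marg(1)[symmetric] by (intro integral_distr) auto
  also have "\<dots> \<le> (\<integral>z. h (snd z) + lam * dst (fst z) (snd z) \<partial>\<kappa>)"
  proof (rule integral_mono)
    show "integrable \<kappa> (\<lambda>z. f (fst z))"
      using f_bound space_\<kappa> by (intro \<kappa>.integrable_const_bound[of _ B]) auto
    show "integrable \<kappa> (\<lambda>z. h (snd z) + lam * dst (fst z) (snd z))"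
      using h_int dst_int by simp
    fix z assume "z \<in> space \<kappa>"
    then have "fst z \<in> space M" by (simp add: space_\<kappa> mem_Times_iff)
    then show "f (fst z) \<le> h (snd z) + lam * dst (fst z) (snd z)"
      using h_ge[of "fst z" "snd z"] by linarith
  qed
  also have "\<dots> = (\<integral>z. h (snd z) \<partial>\<kappa>) + lam * (\<integral>z. dst (fst z) (snd z) \<partial>\<kappa>)"
    using h_int dst_int by simp
  also have "(\<integral>z. h (snd z) \<partial>\<kappa>) = (\<integral>y. h y \<partial>empirical M N xs)"
    unfolding marg(2)[symmetric] by (intro integral_distr[symmetric]) auto
  also have "\<dots> = avg (\<lambda>s. h (xs s))"
    by (rule integral_empirical[OF h_meas])
  also have "\<dots> \<le> avg \<eta>"
  proof -
    have "h (xs s) \<le> \<eta> s" if "s \<in> {1..N}" for s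
      unfolding h_def using that by (intro Min_le) (auto intro!: image_eqI[where x = s])
    then show ?thesis unfolding avg_def by (intro mult_left_mono sum_mono) auto
  qed
  also have "lam * (\<integral>z. dst (fst z) (snd z) \<partial>\<kappa>) \<le> lam * (\<theta> + \<delta>)"
    using dst_le lam by (rule mult_left_mono)
  also have "avg \<eta> + lam * (\<theta> + \<delta>) \<le> lam * \<theta> + avg \<eta> + \<epsilon>"
    using \<delta> by (simp add: algebra_simps)
  finally show "(\<integral>x. f x \<partial>Q) \<le> lam * \<theta> + avg \<eta> + \<epsilon>" by simp
qed

text \<open>The adversary may transport the \<open>s\<close>-th atom to \<open>x s\<close> with probability \<open>c\<close> and
  to \<open>x' s\<close> otherwise.  Such two-point mixtures are all the adversarial measures that strong
  duality needs.\<close>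

lemma mixture_in_ball:
  assumes c: "0 \<le> c" "c \<le> 1"
    and x: "\<And>s. s \<in> {1..N} \<Longrightarrow> x s \<in> space M" and x': "\<And>s. s \<in> {1..N} \<Longrightarrow> x' s \<in> space M"
    and budget: "c * avg (\<lambda>s. dst (x s) (xs s)) + (1 - c) * avg (\<lambda>s. dst (x' s) (xs s)) \<le> \<theta>"
  shows "\<exists>Q\<in>W_ball \<theta>. (\<integral>y. f y \<partial>Q) = c * avg (\<lambda>s. f (x s)) + (1 - c) * avg (\<lambda>s. f (x' s))"
proof -
  define \<rho> where "\<rho> = pair_pmf (bernoulli_pmf c) (pmf_of_set {1..N})"
  \<comment> \<open>The index measure lives on all of \<open>nat\<close>, so indices off \<open>{1..N}\<close>, which have
    probability zero, are redirected to the first atom to keep the maps inside \<open>space M\<close>.\<close>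
  define cl where "cl s = (if s \<in> {1..N} then s else 1)" for s
  define X where "X = (\<lambda>(b, s). if b then x (cl s) else x' (cl s))"
  define Y where "Y = (\<lambda>(b :: bool, s). xs (cl s))"
  have cl: "cl s \<in> {1..N}" for s using N by (auto simp: cl_def)
  have X_space: "X a \<in> space M" and Y_space: "Y a \<in> space M" for a
    using x x' atom cl by (auto simp: X_def Y_def split: prod.splits)
  define \<kappa> where "\<kappa> = distr (measure_pmf \<rho>) (M \<Otimes>\<^sub>M M) (\<lambda>a. (X a, Y a))"
  have meas [measurable]: "(\<lambda>a. (X a, Y a)) \<in> measurable (measure_pmf \<rho>) (M \<Otimes>\<^sub>M M)"
    "X \<in> measurable (measure_pmf \<rho>) M" "Y \<in> measurable (measure_pmf \<rho>) M"
    using X_space Y_space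
    by (auto intro!: measurableI measurable_Pair simp: space_pair_measure simp del: split_paired_All)
  have fin: "finite (set_pmf \<rho>)"
    unfolding \<rho>_def using N finite_subset[of "set_pmf (bernoulli_pmf c)" UNIV] by simp
  have exp: "measure_pmf.expectation \<rho> g
      = c * avg (\<lambda>s. g (True, s)) + (1 - c) * avg (\<lambda>s. g (False, s))" for g :: "bool \<times> nat \<Rightarrow> real"
  proof -
    have "measure_pmf.expectation \<rho> g = (\<Sum>a\<in>UNIV \<times> {1..N}. g a * pmf \<rho> a)"
      using N by (intro integral_measure_pmf_real) (auto simp: \<rho>_def)
    also have "\<dots> = (\<Sum>b\<in>UNIV. \<Sum>s\<in>{1..N}. g (b, s) * pmf \<rho> (b, s))"
      by (simp add: sum.cartesian_product)
    also have "\<dots> = c * avg (\<lambda>s. g (True, s)) + (1 - c) * avg (\<lambda>s. g (False, s))"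
      using N c by (simp add: UNIV_bool \<rho>_def pmf_pair avg_def sum_distrib_left mult_ac)
    finally show ?thesis .
  qed
  define Q where "Q = distr (measure_pmf \<rho>) M X"
  have fst_\<kappa>: "distr \<kappa> M fst = Q"
    unfolding \<kappa>_def Q_def using meas(1) by (subst distr_distr) (simp_all only: measurable_fst comp_def fst_conv)
  have "distr \<kappa> M snd = distr (measure_pmf \<rho>) M Y"
    unfolding \<kappa>_def using meas(1) by (subst distr_distr) (simp_all only: measurable_snd comp_def snd_conv)
  also have "\<dots> = distr (measure_pmf (map_pmf snd \<rho>)) M (\<lambda>s. xs (cl s))"
    unfolding map_pmf_rep_eq using atom cl
    by (subst distr_distr) (auto simp: comp_def Y_def case_prod_unfold)
  also have "\<dots> = empirical M N xs"
    unfolding empirical_eq_distr \<rho>_def map_snd_pair_pmf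
    by (rule arg_cong[where f = "distr _ M"]) (auto simp: cl_def)
  finally have "\<kappa> \<in> couplings M Q (empirical M N xs)"
    using fst_\<kappa> measure_pmf.prob_space_distr[OF meas(1)]
    by (simp add: couplings_def prob_measures_def \<kappa>_def)
  then have "wasserstein M dst Q (empirical M N xs) \<le> (\<integral>\<^sup>+ z. ennreal (dst (fst z) (snd z)) \<partial>\<kappa>)"
    unfolding wasserstein_def by (rule INF_lower)
  also have "\<dots> = (\<integral>\<^sup>+ a. ennreal (dst (X a) (Y a)) \<partial>measure_pmf \<rho>)"
    unfolding \<kappa>_def using dst_measurable by (subst nn_integral_distr[OF meas(1)]) simp_all
  also have "\<dots> = ennreal (measure_pmf.expectation \<rho> (\<lambda>a. dst (X a) (Y a)))"
    using fin dst_nonneg by (intro nn_integral_eq_integral integrable_measure_pmf_finite) auto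
  also have "measure_pmf.expectation \<rho> (\<lambda>a. dst (X a) (Y a)) \<le> \<theta>"
    using budget avg_cong[of "\<lambda>s. dst (x (cl s)) (xs (cl s))" "\<lambda>s. dst (x s) (xs s)"]
      avg_cong[of "\<lambda>s. dst (x' (cl s)) (xs (cl s))" "\<lambda>s. dst (x' s) (xs s)"]
    by (simp add: exp X_def Y_def cl_def)
  finally have "wasserstein M dst Q (empirical M N xs) \<le> ennreal \<theta>"
    by (simp add: ennreal_leI)
  then have "Q \<in> W_ball \<theta>"
    using measure_pmf.prob_space_distr[OF meas(2)]
    by (simp add: wasserstein_ball_def prob_measures_def Q_def)
  moreover have "(\<integral>y. f y \<partial>Q) = measure_pmf.expectation \<rho> (\<lambda>a. f (X a))"
    unfolding Q_def by (rule integral_distr[OF meas(2) f_measurable])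
  then have "(\<integral>y. f y \<partial>Q) = c * avg (\<lambda>s. f (x s)) + (1 - c) * avg (\<lambda>s. f (x' s))"
    using avg_cong[of "\<lambda>s. f (x (cl s))" "\<lambda>s. f (x s)"]
      avg_cong[of "\<lambda>s. f (x' (cl s))" "\<lambda>s. f (x' s)"]
    by (simp add: exp X_def cl_def)
  ultimately show ?thesis by blast
qed

text \<open>The multiplier is the slope of a supporting line: each way \<open>x\<close> of moving all atoms gives
  a point (mean cost \<open>a x\<close>, mean value \<open>b x\<close>) in the plane, and mixing two of them shows that
  every chord lies below \<open>v\<close> at \<open>\<theta>\<close>.  Moving nothing costs \<open>0 < \<theta>\<close>, which is the Slater
  point.  The bound by the line is additive over the atoms, so each can be maximized on its own.\<close>

lemma exists_dual_multiplier:
  assumes \<theta>: "0 < \<theta>" and v: "\<And>Q. Q \<in> W_ball \<theta> \<Longrightarrow> (\<integral>x. f x \<partial>Q) \<le> v"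
  shows "\<exists>lam\<ge>0. lam * \<theta> + avg (\<lambda>s. SUP x\<in>space M. f x - lam * dst x (xs s)) \<le> v"
proof -
  define I where "I = Pi\<^sub>E {1..N} (\<lambda>_. space M)"
  define a where "a x = avg (\<lambda>s. dst (x s) (xs s))" for x
  define b where "b x = avg (\<lambda>s. f (x s))" for x
  have mix: "c * b x + (1 - c) * b x' \<le> v"
    if "x \<in> I" "x' \<in> I" "0 \<le> c" "c \<le> 1" "c * a x + (1 - c) * a x' \<le> \<theta>" for c x x'
  proof -
    have "x s \<in> space M" "x' s \<in> space M" if "s \<in> {1..N}" for s
      using \<open>x \<in> I\<close> \<open>x' \<in> I\<close> that by (auto simp: I_def)
    then obtain Q where "Q \<in> W_ball \<theta>" "(\<integral>y. f y \<partial>Q) = c * b x + (1 - c) * b x'"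
      using mixture_in_ball[of c x x' \<theta>] \<open>0 \<le> c\<close> \<open>c \<le> 1\<close> \<open>c * a x + (1 - c) * a x' \<le> \<theta>\<close>
      unfolding a_def b_def by blast
    then show ?thesis using v[of Q] by simp
  qed
  have "\<exists>lam\<ge>0. \<forall>x\<in>I. b x \<le> v + lam * (a x - \<theta>)"
  proof (rule supporting_slope)
    show "restrict xs {1..N} \<in> I" unfolding I_def using atom by auto
    show "a (restrict xs {1..N}) < \<theta>" using \<theta> avg_cong[of "\<lambda>s. dst (restrict xs {1..N} s) (xs s)" "\<lambda>_. 0"]
      by (simp add: a_def dst_self) (simp add: avg_def)
    show "b x \<le> v" if "x \<in> I" "a x \<le> \<theta>" for x
      using mix[of x x 1] that by simp
    fix x x' assume x: "x \<in> I" "x' \<in> I" "a x < \<theta>" "\<theta> < a x'"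
    define c where "c = (a x' - \<theta>) / (a x' - a x)"
    have c: "1 - c = (\<theta> - a x) / (a x' - a x)" using x by (simp add: c_def field_simps)
    have "c * (a x' - a x) = a x' - \<theta>" using x by (simp add: c_def)
    then have "c * a x + (1 - c) * a x' = \<theta>" by (simp add: algebra_simps)
    then have "c * b x + (1 - c) * b x' \<le> v"
      using x by (intro mix) (auto simp: c_def field_simps)
    then show "(a x' - \<theta>) / (a x' - a x) * b x + (\<theta> - a x) / (a x' - a x) * b x' \<le> v"
      unfolding c unfolding c_def .
  qed
  then obtain lam where lam: "0 \<le> lam" and sup: "\<And>x. x \<in> I \<Longrightarrow> b x \<le> v + lam * (a x - \<theta>)"
    by blast
  have "(\<Sum>s\<in>{1..N}. SUP x\<in>space M. f x - lam * dst x (xs s)) \<le> real N * (v - lam * \<theta>)"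
  proof (rule sum_SUP_le)
    fix x assume "x \<in> (\<Pi>\<^sub>E s\<in>{1..N}. space M)"
    then have "b x - lam * a x \<le> v - lam * \<theta>"
      using sup[of x] by (simp add: I_def algebra_simps)
    moreover have "(\<Sum>s\<in>{1..N}. f (x s) - lam * dst (x s) (xs s)) = real N * (b x - lam * a x)"
      using N by (simp add: a_def b_def avg_def sum_subtractf sum_distrib_left[symmetric] field_simps)
    ultimately show "(\<Sum>s\<in>{1..N}. f (x s) - lam * dst (x s) (xs s)) \<le> real N * (v - lam * \<theta>)"
      by (simp add: mult_left_mono)
  qed (use atom N in auto)
  then have "lam * \<theta> + avg (\<lambda>s. SUP x\<in>space M. f x - lam * dst x (xs s)) \<le> v"
    using N by (simp add: avg_def field_simps)
  then show ?thesis using lam by blast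
qed

lemma SUP_dual_bound:
  assumes "0 \<le> lam" "x \<in> space M"
  shows "f x - lam * dst x (xs s) \<le> (SUP x\<in>space M. f x - lam * dst x (xs s))"
proof (rule cSUP_upper[OF assms(2)])
  have "f x - lam * dst x (xs s) \<le> B" if "x \<in> space M" for x
    using f_bound[OF that] mult_nonneg_nonneg[OF assms(1) dst_nonneg[of x "xs s"]] by auto
  then show "bdd_above ((\<lambda>x. f x - lam * dst x (xs s)) ` space M)"
    by (auto intro!: bdd_aboveI)
qed

text \<open>The worst case equals the dual value at a multiplier, so the dual minimum is attained even where
  no worst-case measure exists.\<close>

theorem strong_duality:
  assumes \<theta>: "0 < \<theta>"
  obtains lam where "0 \<le> lam"
    and "(SUP Q\<in>W_ball \<theta>. ereal (\<integral>x. f x \<partial>Q))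
      = ereal (lam * \<theta> + avg (\<lambda>s. SUP x\<in>space M. f x - lam * dst x (xs s)))"
proof -
  have weak: "(SUP Q\<in>W_ball \<theta>. ereal (\<integral>x. f x \<partial>Q))
      \<le> ereal (lam * \<theta> + avg (\<lambda>s. SUP x\<in>space M. f x - lam * dst x (xs s)))" if "0 \<le> lam" for lam
    using that \<theta> SUP_dual_bound by (intro SUP_least) (auto intro!: integral_le_dual)
  obtain Q where Q: "Q \<in> W_ball \<theta>"
    using mixture_in_ball[of 1 xs xs \<theta>] \<theta> atom by (auto simp: dst_self avg_def)
  have "(SUP Q\<in>W_ball \<theta>. ereal (\<integral>x. f x \<partial>Q)) \<noteq> \<infinity>" using weak[of 0] by auto
  moreover have "(SUP Q\<in>W_ball \<theta>. ereal (\<integral>x. f x \<partial>Q)) \<noteq> -\<infinity>"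
    using SUP_upper[OF Q, of "\<lambda>Q. ereal (\<integral>x. f x \<partial>Q)"] by auto
  ultimately obtain v where v: "(SUP Q\<in>W_ball \<theta>. ereal (\<integral>x. f x \<partial>Q)) = ereal v"
    by (cases "SUP Q\<in>W_ball \<theta>. ereal (\<integral>x. f x \<partial>Q)") auto
  have "(\<integral>x. f x \<partial>Q) \<le> v" if "Q \<in> W_ball \<theta>" for Q
    using SUP_upper[OF that, of "\<lambda>Q. ereal (\<integral>x. f x \<partial>Q)"] v by simp
  then obtain lam where "0 \<le> lam"
    "lam * \<theta> + avg (\<lambda>s. SUP x\<in>space M. f x - lam * dst x (xs s)) \<le> v"
    using exists_dual_multiplier[OF \<theta>] by blast
  moreover have "v \<le> lam * \<theta> + avg (\<lambda>s. SUP x\<in>space M. f x - lam * dst x (xs s))"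
    using weak[OF \<open>0 \<le> lam\<close>] v by simp
  ultimately have "v = lam * \<theta> + avg (\<lambda>s. SUP x\<in>space M. f x - lam * dst x (xs s))"
    by linarith
  then show ?thesis
    using that[OF \<open>0 \<le> lam\<close>] v by simp
qed

end

section \<open>The lifting of one component\<close>

text \<open>One disturbance component.  On each piece \<open>[w (j - 1), w j)\<close>, and on the closed last piece,
  the lifting is affine, with jumps at the breakpoints, so it is governed by its values at left
  endpoints and its left limits at right endpoints.  Pieces may be degenerate.\<close>

locale breakpoint_grid =
  fixes p :: nat and w :: "nat \<Rightarrow> real"
  assumes p: "1 \<le> p" and step: "\<And>j. j \<in> {1..p} \<Longrightarrow> w (j - 1) \<le> w j"
begin

lemma w_mono: "i \<le> j \<Longrightarrow> j \<le> p \<Longrightarrow> w i \<le> w j"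
proof (induction j rule: dec_induct)
  case (step m)
  then show ?case using step.prems breakpoint_grid.step[OF breakpoint_grid_axioms, of "Suc m"] by simp
qed simp

lemma lift_G_index:
  "m < p + (p - 1) \<Longrightarrow>
    lift_G p w x $ m = (if m < p then lift_V w (Suc m) x else lift_Q w (Suc (m - p)) x)"
  by (auto simp: lift_G_def vec_V_def vec_Q_def)

lemma dim_lift_G [simp]: "dim_vec (lift_G p w x) = p + (p - 1)"
  by (simp add: lift_G_def vec_V_def vec_Q_def)

lemma dim_lift_G_left [simp]: "dim_vec (lift_G_left p w x) = p + (p - 1)"
  by (simp add: lift_G_left_def)

lemma lift_V_piece:
  assumes j: "j \<in> {1..p}" "w (j - 1) \<le> x" "x \<le> w j" and i: "i \<in> {1..p}"
  shows "lift_V w i x = lift_V w i (w (j - 1)) + (if i = j then x - w (j - 1) else 0)"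
proof (cases i j rule: linorder_cases)
  case less
  then have "w i \<le> w (j - 1)" using j by (intro w_mono) auto
  then show ?thesis using less j by (cases "i = 1") (simp_all add: lift_V_def)
next
  case equal
  then show ?thesis using j step[of j] by (auto simp: lift_V_def)
next
  case greater
  then have "w j \<le> w (i - 1)" "w (i - 1) \<le> w i" using i j by (auto intro!: w_mono)
  then show ?thesis using greater j by (auto simp: lift_V_def)
qed

lemma lift_Q_piece:
  assumes j: "j \<in> {1..p}" "w (j - 1) \<le> x" "x < w j \<or> j = p" and i: "i \<in> {1..p - 1}"
  shows "lift_Q w i x = lift_Q w i (w (j - 1))"
proof (cases "i < j")
  case True
  then have "w i \<le> w (j - 1)" using j by (intro w_mono) auto
  then show ?thesis using j by (simp add: lift_Q_def)
next
  case False
  then have "w j \<le> w i" "x < w j" using i j by (auto intro!: w_mono)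
  then show ?thesis using j by (simp add: lift_Q_def)
qed

text \<open>Within the \<open>j\<close>-th piece only the coordinate \<open>V j\<close> moves, with slope one; all
  other \<open>V\<close>'s are saturated or zero and the \<open>Q\<close>'s are constant.  The last piece is closed because
  the last breakpoint has no indicator of its own.\<close>

lemma lift_G_affine_on_piece:
  assumes j: "j \<in> {1..p}" "w (j - 1) \<le> x" "x \<le> w j" "x < w j \<or> j = p"
  shows "c \<bullet> lift_G p w x = c \<bullet> lift_G p w (w (j - 1)) + c $ (j - 1) * (x - w (j - 1))"
proof -
  let ?D = "p + (p - 1)"
  have "lift_G p w x $ m = lift_G p w (w (j - 1)) $ m + (if m = j - 1 then x - w (j - 1) else 0)"
    if "m < ?D" for m
  proof (cases "m < p")
    case True
    then show ?thesis
      using lift_V_piece[OF j(1-3), of "Suc m"] that j(1) by (auto simp: lift_G_index)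
  next
    case False
    then show ?thesis
      using lift_Q_piece[OF j(1,2,4), of "Suc (m - p)"] that j(1) by (auto simp: lift_G_index)
  qed
  then have "c \<bullet> lift_G p w x
      = (\<Sum>m\<in>{0..<?D}. c $ m * lift_G p w (w (j - 1)) $ m
          + (if m = j - 1 then c $ (j - 1) * (x - w (j - 1)) else 0))"
    unfolding scalar_prod_def by (intro sum.cong) (auto simp: algebra_simps)
  also have "\<dots> = c \<bullet> lift_G p w (w (j - 1)) + c $ (j - 1) * (x - w (j - 1))"
    using j(1) by (simp add: sum.distrib scalar_prod_def) linarith
  finally show ?thesis .
qed

lemma piece_containing:
  assumes "w 0 \<le> x" "x \<le> w p"
  obtains j where "j \<in> {1..p}" "w (j - 1) \<le> x" "x \<le> w j" "x < w j \<or> j = p"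
proof -
  define j where "j = (LEAST j. 1 \<le> j \<and> (x < w j \<or> j = p))"
  have j: "1 \<le> j \<and> (x < w j \<or> j = p)"
    unfolding j_def by (rule LeastI[of _ p]) (use p in auto)
  have "j \<le> p" unfolding j_def by (rule Least_le) (use p in auto)
  have "w (j - 1) \<le> x"
  proof (cases "j = 1")
    case False
    then show ?thesis
      using not_less_Least[of "j - 1" "\<lambda>j. 1 \<le> j \<and> (x < w j \<or> j = p)"] j
      unfolding j_def[symmetric] by auto
  qed (use assms in simp)
  then show ?thesis using that[of j] j \<open>j \<le> p\<close> assms by auto
qed

lemma sum_lift_V: "1 \<le> k \<Longrightarrow> k \<le> p \<Longrightarrow> (\<Sum>m<k. lift_V w (Suc m) x) = min x (w k)"
proof (induction k rule: dec_induct)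
  case base
  show ?case by (simp add: lift_V_def)
next
  case (step k)
  then show ?case
    using breakpoint_grid.step[OF breakpoint_grid_axioms, of "Suc k"] by (auto simp: lift_V_def)
qed

lemma retract_lift_G:
  assumes "x \<le> w p"
  shows "retract_R p \<bullet> lift_G p w x = x"
proof -
  have "retract_R p \<bullet> lift_G p w x = (\<Sum>m<p. lift_V w (Suc m) x)"
    unfolding retract_R_def lift_G_def
    by (subst scalar_prod_append[of _ p _ "p - 1"])
      (auto simp: vec_V_def vec_Q_def scalar_prod_def atLeast0LessThan)
  then show ?thesis using sum_lift_V[of p x] p assms by simp
qed

lemma lift_G_left_limit:
  assumes "x \<noteq> w 0"
  shows "((\<lambda>y. c \<bullet> lift_G p w y) \<longlongrightarrow> c \<bullet> lift_G_left p w x) (at_left x)"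
  unfolding scalar_prod_def dim_lift_G dim_lift_G_left
  by (intro tendsto_intros lift_G_left_tendsto) (use assms in auto)

lemma retract_lift_G_left:
  assumes j: "j \<in> {1..p}"
  shows "retract_R p \<bullet> lift_G_left p w (w j) = w j"
proof (cases "w j = w 0")
  case True
  then show ?thesis using j w_mono[of j p] by (simp add: lift_G_left_def retract_lift_G)
next
  case False
  have "\<forall>\<^sub>F y in at_left (w j). y = retract_R p \<bullet> lift_G p w y"
    using j w_mono[of j p]
    by (auto simp: eventually_at_left_field retract_lift_G intro!: exI[of _ "w j - 1"])
  then have "((\<lambda>y. retract_R p \<bullet> lift_G p w y) \<longlongrightarrow> w j) (at_left (w j))"
    by (rule Lim_transform_eventually[rotated]) (rule tendsto_ident_at)
  with lift_G_left_limit[OF False] show ?thesis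
    by (rule tendsto_unique[rotated]) simp
qed

lemma lift_G_left_on_piece:
  assumes j: "j \<in> {1..p}" and strict: "w (j - 1) < w j"
  shows "c \<bullet> lift_G_left p w (w j)
    = c \<bullet> lift_G p w (w (j - 1)) + c $ (j - 1) * (w j - w (j - 1))"
proof -
  have "w 0 \<le> w (j - 1)" using j by (intro w_mono) auto
  then have "w j \<noteq> w 0" using strict by auto
  have "\<forall>\<^sub>F y in at_left (w j).
      c \<bullet> lift_G p w (w (j - 1)) + c $ (j - 1) * (y - w (j - 1)) = c \<bullet> lift_G p w y"
    using eventually_at_left_real[OF strict]
    by eventually_elim (rule lift_G_affine_on_piece[OF j, symmetric]; simp)
  moreover have "((\<lambda>y. c \<bullet> lift_G p w (w (j - 1)) + c $ (j - 1) * (y - w (j - 1)))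
      \<longlongrightarrow> c \<bullet> lift_G p w (w (j - 1)) + c $ (j - 1) * (w j - w (j - 1))) (at_left (w j))"
    by (intro tendsto_intros)
  ultimately have "((\<lambda>y. c \<bullet> lift_G p w y)
      \<longlongrightarrow> c \<bullet> lift_G p w (w (j - 1)) + c $ (j - 1) * (w j - w (j - 1))) (at_left (w j))"
    by (rule Lim_transform_eventually[rotated])
  with lift_G_left_limit[OF \<open>w j \<noteq> w 0\<close>] show ?thesis
    by (rule tendsto_unique[rotated]) simp
qed

text \<open>A supremum over the interval also bounds the left limits, since these are limits of values; at
  \<open>w 0\<close> the left limit is by convention a value.\<close>

lemma left_limit_penalized_le:
  assumes H: "\<And>x. x \<in> {w 0..w p} \<Longrightarrow> c \<bullet> lift_G p w x - lam * \<bar>x - \<xi>\<bar> \<le> H" and j: "j \<in> {1..p}"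
  shows "c \<bullet> lift_G_left p w (w j) - lam * \<bar>w j - \<xi>\<bar> \<le> H"
proof (cases "w j = w 0")
  case True
  then show ?thesis using H[of "w 0"] w_mono[of 0 p] by (simp add: lift_G_left_def)
next
  case False
  have le: "w 0 \<le> w j" "w j \<le> w p" using j by (auto intro!: w_mono)
  show ?thesis
  proof (rule tendsto_upperbound)
    show "((\<lambda>y. c \<bullet> lift_G p w y - lam * \<bar>y - \<xi>\<bar>)
        \<longlongrightarrow> c \<bullet> lift_G_left p w (w j) - lam * \<bar>w j - \<xi>\<bar>) (at_left (w j))"
      by (intro tendsto_intros lift_G_left_limit False)
    show "\<forall>\<^sub>F y in at_left (w j). c \<bullet> lift_G p w y - lam * \<bar>y - \<xi>\<bar> \<le> H"
      using eventually_at_left_real[of "w 0" "w j"] le False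
      by (auto elim!: eventually_mono intro!: H)
  qed simp
qed

text \<open>Linearizing the penalty \<open>lam * \<bar>x - \<xi>\<bar>\<close> on one piece.  If \<open>\<xi>\<close> is not interior, the penalty is
  already linear there and \<open>\<zeta> = lam\<close> or \<open>\<zeta> = - lam\<close>.  If it is interior, the penalized affine
  function peaks at \<open>\<xi>\<close> or at an endpoint, and \<open>\<zeta>\<close> is the slope of the piece cut off to
  \<open>[- lam, lam]\<close>.\<close>

lemma exists_piece_multiplier:
  assumes lam: "0 \<le> lam"
    and H: "\<And>x. x \<in> {w 0..w p} \<Longrightarrow> c \<bullet> lift_G p w x - lam * \<bar>x - \<xi>\<bar> \<le> H" and j: "j \<in> {1..p}"
  shows "\<exists>\<zeta>. \<bar>\<zeta>\<bar> \<le> lam \<and> c \<bullet> lift_G_left p w (w j) - \<zeta> * (w j - \<xi>) \<le> H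
    \<and> c \<bullet> lift_G p w (w (j - 1)) - \<zeta> * (w (j - 1) - \<xi>) \<le> H"
proof -
  let ?L = "c \<bullet> lift_G_left p w (w j)" and ?R = "c \<bullet> lift_G p w (w (j - 1))"
  define m where "m = c $ (j - 1)"
  have range: "w 0 \<le> w (j - 1)" "w (j - 1) \<le> w j" "w j \<le> w p" using j by (auto intro!: w_mono)
  have L: "?L - lam * \<bar>w j - \<xi>\<bar> \<le> H" by (rule left_limit_penalized_le[OF H j])
  have R: "?R - lam * \<bar>w (j - 1) - \<xi>\<bar> \<le> H" using range by (intro H) auto
  consider "\<xi> \<le> w (j - 1)" | "w j \<le> \<xi>" | "w (j - 1) < \<xi>" "\<xi> < w j" by linarith
  then show ?thesis
  proof cases
    case 1
    then show ?thesis using L R range lam by (intro exI[of _ lam]) auto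
  next
    case 2
    then have "\<bar>w j - \<xi>\<bar> = - (w j - \<xi>)" "\<bar>w (j - 1) - \<xi>\<bar> = - (w (j - 1) - \<xi>)"
      using range by linarith+
    then show ?thesis using L R lam by (intro exI[of _ "- lam"]) (simp add: algebra_simps)
  next
    case 3
    \<comment> \<open>the value at \<open>\<xi>\<close>, where there is no penalty\<close>
    have centre: "?R + m * (\<xi> - w (j - 1)) \<le> H"
      using H[of \<xi>] lift_G_affine_on_piece[OF j, of \<xi> c] range 3 by (simp add: m_def)
    have L_eq: "?L = ?R + m * (w j - w (j - 1))"
      using lift_G_left_on_piece[OF j] 3 by (simp add: m_def)
    define \<zeta> where "\<zeta> = max (- lam) (min lam m)"
    consider "\<zeta> = m" | "\<zeta> = lam" "lam < m" | "\<zeta> = - lam" "m < - lam"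
      using lam unfolding \<zeta>_def by linarith
    then have "?L - \<zeta> * (w j - \<xi>) \<le> H \<and> ?R - \<zeta> * (w (j - 1) - \<xi>) \<le> H"
    proof cases
      case 1
      then show ?thesis using centre L_eq by (simp add: algebra_simps)
    next
      case 2
      have "(m - lam) * (w (j - 1) - \<xi>) \<le> 0" using 2 3 by (intro mult_nonneg_nonpos) auto
      then show ?thesis using L centre 2 3 by (simp add: algebra_simps)
    next
      case 3
      have "(m + lam) * (w j - \<xi>) \<le> 0" using 3 \<open>\<xi> < w j\<close> by (intro mult_nonpos_nonneg) auto
      then show ?thesis using R centre 3 L_eq \<open>w (j - 1) < \<xi>\<close> by (simp add: algebra_simps)
    qed
    moreover have "\<bar>\<zeta>\<bar> \<le> lam" using lam unfolding \<zeta>_def by auto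
    ultimately show ?thesis by blast
  qed
qed

text \<open>Conversely, an affine function on a piece is bounded by its two end values, and
  \<open>\<zeta> * (x - \<xi>)\<close> never exceeds the penalty when \<open>\<bar>\<zeta>\<bar> \<le> lam\<close>.  A degenerate piece consists of its left
  endpoint.\<close>

lemma penalized_le_of_piece_multipliers:
  assumes \<zeta>: "\<And>j. j \<in> {1..p} \<Longrightarrow> \<bar>\<zeta> j\<bar> \<le> lam"
    "\<And>j. j \<in> {1..p} \<Longrightarrow> c \<bullet> lift_G_left p w (w j) - \<zeta> j * (w j - \<xi>) \<le> H"
    "\<And>j. j \<in> {1..p} \<Longrightarrow> c \<bullet> lift_G p w (w (j - 1)) - \<zeta> j * (w (j - 1) - \<xi>) \<le> H"
    and x: "x \<in> {w 0..w p}"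
  shows "c \<bullet> lift_G p w x - lam * \<bar>x - \<xi>\<bar> \<le> H"
proof -
  obtain j where j: "j \<in> {1..p}" "w (j - 1) \<le> x" "x \<le> w j" "x < w j \<or> j = p"
    by (rule piece_containing[of x]) (use x in simp_all)
  have "c \<bullet> lift_G p w x - \<zeta> j * (x - \<xi>) \<le> H"
  proof (cases "w (j - 1) < w j")
    case False
    then have "x = w (j - 1)" using j by auto
    then show ?thesis using \<zeta>(3)[OF j(1)] by simp
  next
    case True
    define \<Delta> where "\<Delta> = w j - w (j - 1)"
    define t where "t = (x - w (j - 1)) / \<Delta>"
    have t: "0 \<le> t" "t \<le> 1" "x = w (j - 1) + t * \<Delta>"
      using True j by (simp_all add: t_def \<Delta>_def)
    define A where "A = c \<bullet> lift_G p w (w (j - 1)) - \<zeta> j * (w (j - 1) - \<xi>)"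
    define C where "C = c \<bullet> lift_G_left p w (w j) - \<zeta> j * (w j - \<xi>)"
    have C: "C = A + (c $ (j - 1) - \<zeta> j) * \<Delta>"
      using lift_G_left_on_piece[OF j(1) True, of c] by (simp add: A_def C_def \<Delta>_def algebra_simps)
    have "c \<bullet> lift_G p w x - \<zeta> j * (x - \<xi>) = A + (c $ (j - 1) - \<zeta> j) * (x - w (j - 1))"
      using lift_G_affine_on_piece[OF j, of c] by (simp add: A_def algebra_simps)
    also have "\<dots> = (1 - t) * A + t * C"
      using t(3) by (simp add: C algebra_simps)
    also have "\<dots> \<le> H"
      using \<zeta>(2,3)[OF j(1)] t by (intro convex_bound_le) (auto simp: A_def C_def)
    finally show ?thesis .
  qed
  moreover have "\<zeta> j * (x - \<xi>) \<le> \<bar>\<zeta> j\<bar> * \<bar>x - \<xi>\<bar>" by (metis abs_ge_self abs_mult)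
  moreover have "\<bar>\<zeta> j\<bar> * \<bar>x - \<xi>\<bar> \<le> lam * \<bar>x - \<xi>\<bar>"
    using \<zeta>(1)[OF j(1)] by (intro mult_right_mono) auto
  ultimately show ?thesis by linarith
qed

text \<open>Monotonicity of the coordinates gives Borel measurability and boundedness of the lifting at
  once, in spite of the jumps.\<close>

lemma mono_lift_G_index: "m < p + (p - 1) \<Longrightarrow> mono (\<lambda>x. lift_G p w x $ m)"
  by (rule monoI) (auto simp: lift_G_index lift_V_def lift_Q_def)

lemma borel_measurable_lift_G: "(\<lambda>x. c \<bullet> lift_G p w x) \<in> borel_measurable borel"
  unfolding scalar_prod_def dim_lift_G
  by (intro borel_measurable_sum borel_measurable_times borel_measurable_const borel_measurable_mono
      mono_lift_G_index) auto

lemma lift_G_bounded: "\<exists>B. \<forall>x\<in>{a..b}. \<bar>c \<bullet> lift_G p w x\<bar> \<le> B"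
proof (intro exI ballI)
  fix x assume x: "x \<in> {a..b}"
  have "\<bar>lift_G p w x $ m\<bar> \<le> \<bar>lift_G p w a $ m\<bar> + \<bar>lift_G p w b $ m\<bar>" if "m < p + (p - 1)" for m
    using monoD[OF mono_lift_G_index[OF that], of a x] monoD[OF mono_lift_G_index[OF that], of x b] x
    by auto
  then show "\<bar>c \<bullet> lift_G p w x\<bar>
      \<le> (\<Sum>m\<in>{0..<p + (p - 1)}. \<bar>c $ m\<bar> * (\<bar>lift_G p w a $ m\<bar> + \<bar>lift_G p w b $ m\<bar>))"
    unfolding scalar_prod_def dim_lift_G
    by (intro order_trans[OF sum_abs] sum_mono) (auto simp: abs_mult intro!: mult_left_mono)
qed

end

section \<open>Stacked vectors and the support hyperrectangle\<close>

lemma scalar_prod_foldr_append: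
  fixes f g :: "'i \<Rightarrow> real vec"
  assumes "\<And>e. e \<in> set es \<Longrightarrow> dim_vec (f e) = dim_vec (g e)"
  shows "foldr (\<lambda>e acc. f e @\<^sub>v acc) es (0\<^sub>v 0) \<bullet> foldr (\<lambda>e acc. g e @\<^sub>v acc) es (0\<^sub>v 0)
    = (\<Sum>e\<leftarrow>es. f e \<bullet> g e)"
  using assms
proof (induction es)
  case Nil
  then show ?case by (simp add: scalar_prod_def)
next
  case (Cons e es)
  let ?F = "foldr (\<lambda>e acc. f e @\<^sub>v acc) es (0\<^sub>v 0)"
  let ?G = "foldr (\<lambda>e acc. g e @\<^sub>v acc) es (0\<^sub>v 0)"
  have dim: "dim_vec (foldr (\<lambda>e acc. h e @\<^sub>v acc) es (0\<^sub>v 0)) = (\<Sum>e\<leftarrow>es. dim_vec (h e))"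
    for h :: "'i \<Rightarrow> real vec"
    by (induction es) simp_all
  have "map (\<lambda>e. dim_vec (f e)) es = map (\<lambda>e. dim_vec (g e)) es"
    using Cons.prems by (intro map_cong) simp_all
  then have "dim_vec ?F = dim_vec ?G" unfolding dim by (rule arg_cong)
  moreover have "dim_vec (f e) = dim_vec (g e)" by (rule Cons.prems) simp
  ultimately have "(f e @\<^sub>v ?F) \<bullet> (g e @\<^sub>v ?G) = f e \<bullet> g e + ?F \<bullet> ?G"
    by (intro scalar_prod_append carrier_vecI) (rule refl | erule sym)+
  moreover have "?F \<bullet> ?G = (\<Sum>e\<leftarrow>es. f e \<bullet> g e)"
    by (rule Cons.IH) (rule Cons.prems, simp)
  ultimately show ?case by (simp only: foldr.simps comp_apply list.map sum_list.Cons)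
qed

lemma stack_scalar_prod:
  assumes "\<And>e. e \<in> disturbance_idx T n \<Longrightarrow> dim_vec (f e) = dim_vec (g e)"
  shows "stack T n f \<bullet> stack T n g = (\<Sum>e\<in>disturbance_idx T n. f e \<bullet> g e)"
proof -
  have set: "set (List.product [1..<Suc T] [1..<Suc n]) = disturbance_idx T n"
    by (auto simp: disturbance_idx_def)
  have "distinct (List.product [1..<Suc T] [1..<Suc n])"
    by (intro distinct_product) simp_all
  then show ?thesis
    unfolding stack_def
    using assms by (subst scalar_prod_foldr_append) (simp_all only: set sum_list_distinct_conv_sum_set)
qed

lemma space_support_space: "space (support_space E l v) = (\<Pi>\<^sub>E e\<in>E. {l e..v e})"
  by (simp add: support_space_def space_PiM space_restrict_space)

lemma support_space_component:
  assumes "e \<in> E"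
  shows "(\<lambda>x. x e) \<in> borel_measurable (support_space E l v)"
  unfolding support_space_def
  by (rule measurable_compose[OF measurable_component_singleton[OF assms]])
    (rule measurable_restrict_space1, simp)

lemma support_space_singleton:
  assumes "finite E" "x \<in> space (support_space E l v)"
  shows "{x} \<in> sets (support_space E l v)"
proof -
  have "x \<in> extensional E" "\<And>e. e \<in> E \<Longrightarrow> x e \<in> {l e..v e}"
    using assms(2) unfolding space_support_space by (simp_all add: PiE_iff)
  then have "{x e} \<in> sets (restrict_space borel {l e..v e})" if "e \<in> E" for e
    using that by (subst sets_restrict_space_iff) simp_all
  then have "(\<Pi>\<^sub>E e\<in>E. {x e}) \<in> sets (support_space E l v)"
    unfolding support_space_def by (rule sets_PiM_I_finite[OF assms(1)])
  then show ?thesis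
    by (simp only: PiE_singleton[OF \<open>x \<in> extensional E\<close>])
qed

lemma dist1_measurable:
  "(\<lambda>z. dist1 E (fst z) (snd z))
    \<in> borel_measurable (support_space E l v \<Otimes>\<^sub>M support_space E l v)"
proof -
  let ?M = "support_space E l v"
  have "(\<lambda>z. fst z e) \<in> borel_measurable (?M \<Otimes>\<^sub>M ?M)" "(\<lambda>z. snd z e) \<in> borel_measurable (?M \<Otimes>\<^sub>M ?M)"
    if "e \<in> E" for e
    using that by (auto intro: measurable_compose[OF measurable_fst support_space_component]
        measurable_compose[OF measurable_snd support_space_component])
  then show ?thesis unfolding dist1_def
    by (intro borel_measurable_sum borel_measurable_abs borel_measurable_diff) auto
qed

section \<open>The reformulation for a fixed policy\<close>

text \<open>The objective for one fixed policy: \<open>d\<close> and \<open>r\<close> are the coefficients that the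
  policy determines.\<close>

locale lifted_objective =
  fixes T n N K :: nat
    and l v :: "nat \<times> nat \<Rightarrow> real"
    and p :: "nat \<times> nat \<Rightarrow> nat"
    and w :: "nat \<times> nat \<Rightarrow> nat \<Rightarrow> real"
    and \<xi>hat :: "nat \<Rightarrow> nat \<times> nat \<Rightarrow> real"
    and d :: "nat \<Rightarrow> nat \<times> nat \<Rightarrow> real vec"
    and r :: "nat \<Rightarrow> real"
  assumes dims: "1 \<le> T" "1 \<le> n" "1 \<le> N" "1 \<le> K"
    and data: "\<And>s. s \<in> {1..N} \<Longrightarrow> \<xi>hat s \<in> space (support_space (disturbance_idx T n) l v)"
    and pieces: "\<And>e. e \<in> disturbance_idx T n \<Longrightarrow> 1 \<le> p e"
    and breakpoints: "\<And>e. e \<in> disturbance_idx T n \<Longrightarrow> w e 0 = l e"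
      "\<And>e. e \<in> disturbance_idx T n \<Longrightarrow> w e (p e) = v e"
      "\<And>e j. e \<in> disturbance_idx T n \<Longrightarrow> j \<in> {1..p e} \<Longrightarrow> w e (j - 1) \<le> w e j"
    and d_dim: "\<And>k e. k \<in> {1..K} \<Longrightarrow> e \<in> disturbance_idx T n \<Longrightarrow>
      d k e \<in> carrier_vec (p e + (p e - 1))"
begin

abbreviation "E \<equiv> disturbance_idx T n"
abbreviation "\<Xi> \<equiv> support_space E l v"

abbreviation block_cost :: "nat \<Rightarrow> nat \<times> nat \<Rightarrow> real \<Rightarrow> real" where
  "block_cost k e x \<equiv> d k e \<bullet> lift_G (p e) (w e) x"

definition cost :: "(nat \<times> nat \<Rightarrow> real) \<Rightarrow> real" where
  "cost \<xi> = (MAX k\<in>{1..K}. stack T n (d k) \<bullet> lift_all T n p w \<xi> + r k)"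

text \<open>A uniform bound of the cost as a term, since the bound is a parameter of the duality locale.\<close>

definition cost_bound :: real where
  "cost_bound = (SOME B. \<forall>\<xi>\<in>space \<Xi>. \<bar>cost \<xi>\<bar> \<le> B)"

lemma finite_E: "finite E"
  by (simp add: disturbance_idx_def)

lemma grid: "e \<in> E \<Longrightarrow> breakpoint_grid (p e) (w e)"
  using pieces breakpoints by unfold_locales auto

lemma cost_eq: "cost \<xi> = (MAX k\<in>{1..K}. (\<Sum>e\<in>E. block_cost k e (\<xi> e)) + r k)"
proof -
  have "stack T n (d k) \<bullet> lift_all T n p w \<xi> = (\<Sum>e\<in>E. block_cost k e (\<xi> e))"
    if "k \<in> {1..K}" for k
    unfolding lift_all_def
    using d_dim[OF that] breakpoint_grid.dim_lift_G[OF grid] by (intro stack_scalar_prod) auto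
  then show ?thesis unfolding cost_def by (intro arg_cong[where f = Max] image_cong) auto
qed

lemma piece_le_cost: "k \<in> {1..K} \<Longrightarrow> (\<Sum>e\<in>E. block_cost k e (\<xi> e)) + r k \<le> cost \<xi>"
  unfolding cost_eq by (intro Max_ge) auto

lemma cost_le_iff:
  "cost \<xi> \<le> c \<longleftrightarrow> (\<forall>k\<in>{1..K}. (\<Sum>e\<in>E. block_cost k e (\<xi> e)) + r k \<le> c)"
proof -
  have "{1..K} \<noteq> {}" using dims by simp
  then show ?thesis unfolding cost_eq by (subst Max_le_iff) blast+
qed

lemma cost_measurable: "cost \<in> borel_measurable \<Xi>"
proof -
  have "(\<lambda>\<xi>. (\<Sum>e\<in>E. block_cost k e (\<xi> e)) + r k) \<in> borel_measurable \<Xi>" for k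
    by (intro borel_measurable_add borel_measurable_sum borel_measurable_const
        measurable_compose[OF support_space_component breakpoint_grid.borel_measurable_lift_G[OF grid]])
  then show ?thesis
    unfolding cost_eq[abs_def] by (intro borel_measurable_Max) auto
qed

lemma cost_bounded: "\<xi> \<in> space \<Xi> \<Longrightarrow> \<bar>cost \<xi>\<bar> \<le> cost_bound"
proof -
  define B where "B k e = (SOME b. \<forall>x\<in>{l e..v e}. \<bar>block_cost k e x\<bar> \<le> b)" for k e
  have B: "\<bar>block_cost k e x\<bar> \<le> B k e" if "e \<in> E" "x \<in> {l e..v e}" for k e x
    using someI_ex[OF breakpoint_grid.lift_G_bounded[OF grid[OF that(1)]]] that(2)
    unfolding B_def by blast
  define U where "U k = (\<Sum>e\<in>E. B k e) + \<bar>r k\<bar>" for k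
  have U: "\<bar>(\<Sum>e\<in>E. block_cost k e (\<xi> e)) + r k\<bar> \<le> U k" if "\<xi> \<in> space \<Xi>" for \<xi> k
  proof -
    have "\<xi> e \<in> {l e..v e}" if "e \<in> E" for e
      using \<open>\<xi> \<in> space \<Xi>\<close> that unfolding space_support_space by (rule PiE_mem)
    then have "(\<Sum>e\<in>E. \<bar>block_cost k e (\<xi> e)\<bar>) \<le> (\<Sum>e\<in>E. B k e)"
      by (intro sum_mono B)
    moreover have "\<bar>\<Sum>e\<in>E. block_cost k e (\<xi> e)\<bar> \<le> (\<Sum>e\<in>E. \<bar>block_cost k e (\<xi> e)\<bar>)"
      by (rule sum_abs)
    ultimately show ?thesis unfolding U_def by linarith
  qed
  have "\<bar>cost \<xi>\<bar> \<le> (\<Sum>k\<in>{1..K}. \<bar>U k\<bar>)" if \<xi>: "\<xi> \<in> space \<Xi>" for \<xi>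
  proof -
    have le: "\<bar>(\<Sum>e\<in>E. block_cost k e (\<xi> e)) + r k\<bar> \<le> (\<Sum>k\<in>{1..K}. \<bar>U k\<bar>)" if "k \<in> {1..K}" for k
    proof -
      have "\<bar>U k\<bar> \<le> (\<Sum>k\<in>{1..K}. \<bar>U k\<bar>)" by (rule member_le_sum[OF that]) auto
      then show ?thesis using U[OF \<xi>, of k] by linarith
    qed
    have "cost \<xi> \<le> (\<Sum>k\<in>{1..K}. \<bar>U k\<bar>)" unfolding cost_le_iff using le by (meson abs_le_D1)
    moreover have "1 \<in> {1..K}" using dims by simp
    then have "- (\<Sum>k\<in>{1..K}. \<bar>U k\<bar>) \<le> cost \<xi>"
      using le[of 1] piece_le_cost[of 1 \<xi>] by linarith
    ultimately show ?thesis by linarith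
  qed
  then have "\<forall>\<xi>\<in>space \<Xi>. \<bar>cost \<xi>\<bar> \<le> cost_bound"
    unfolding cost_bound_def by (intro someI_ex[of "\<lambda>B. \<forall>\<xi>\<in>space \<Xi>. \<bar>cost \<xi>\<bar> \<le> B"]) blast
  then show "\<xi> \<in> space \<Xi> \<Longrightarrow> \<bar>cost \<xi>\<bar> \<le> cost_bound" by blast
qed

sublocale transport: empirical_transport \<Xi> "dist1 E" N \<xi>hat cost cost_bound
proof
  show "(\<lambda>z. dist1 E (fst z) (snd z)) \<in> borel_measurable (\<Xi> \<Otimes>\<^sub>M \<Xi>)" by (rule dist1_measurable)
  show "cost \<in> borel_measurable \<Xi>" by (rule cost_measurable)
  show "1 \<le> N" by (rule dims)
  show "\<xi>hat s \<in> space \<Xi>" if "s \<in> {1..N}" for s by (rule data[OF that])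
  show "{\<xi>hat s} \<in> sets \<Xi>" if "s \<in> {1..N}" for s
    by (rule support_space_singleton[OF finite_E data[OF that]])
  show "0 \<le> dist1 E x y" for x y by (simp add: dist1_def sum_nonneg)
  show "dist1 E x x = 0" for x by (simp add: dist1_def)
  show "\<bar>cost x\<bar> \<le> cost_bound" if "x \<in> space \<Xi>" for x by (rule cost_bounded[OF that])
qed

lemma penalized_sum:
  "(\<Sum>e\<in>E. block_cost k e (x e) - lam * \<bar>x e - y e\<bar>) + r k
    = (\<Sum>e\<in>E. block_cost k e (x e)) + r k - lam * dist1 E x y"
  by (simp add: dist1_def sum_subtractf sum_distrib_left)

lemma retract_at_breakpoints:
  assumes "e \<in> E" "j \<in> {1..p e}"
  shows "retract_R (p e) \<bullet> lift_G_left (p e) (w e) (w e j) = w e j"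
    and "retract_R (p e) \<bullet> lift_G (p e) (w e) (w e (j - 1)) = w e (j - 1)"
  using assms breakpoint_grid.w_mono[OF grid[OF assms(1)], of "j - 1" "p e"]
  by (auto intro: breakpoint_grid.retract_lift_G_left breakpoint_grid.retract_lift_G grid)

text \<open>A feasible point certifies a pointwise majorant of the cost.  Summing the componentwise
  bounds is possible because, for fixed \<open>k\<close>, both the cost and the 1-norm separate over the
  components.\<close>

lemma feasible_dominates:
  assumes feas: "reformulation_feasible T n N K p w \<xi>hat d r lam \<eta> \<eta>b \<zeta>"
  shows "0 \<le> lam"
    and "s \<in> {1..N} \<Longrightarrow> \<xi> \<in> space \<Xi> \<Longrightarrow> cost \<xi> - lam * dist1 E \<xi> (\<xi>hat s) \<le> \<eta> s"
proof -
  note feas = feas[unfolded reformulation_feasible_def, rule_format]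
  have "(1, 1) \<in> E" using dims by (simp add: disturbance_idx_def)
  then have "\<bar>\<zeta> 1 1 (1, 1) 1\<bar> \<le> lam"
    using feas[of 1 1] dims pieces[of "(1, 1)"] by simp
  then show "0 \<le> lam" by linarith
  assume s: "s \<in> {1..N}" and \<xi>: "\<xi> \<in> space \<Xi>"
  have "(\<Sum>e\<in>E. block_cost k e (\<xi> e)) + r k \<le> \<eta> s + lam * dist1 E \<xi> (\<xi>hat s)"
    if k: "k \<in> {1..K}" for k
  proof -
    have "block_cost k e (\<xi> e) - lam * \<bar>\<xi> e - \<xi>hat s e\<bar> \<le> \<eta>b s k e" if e: "e \<in> E" for e
    proof (rule breakpoint_grid.penalized_le_of_piece_multipliers[OF grid[OF e]])
      show "\<xi> e \<in> {w e 0..w e (p e)}"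
        using \<xi> e breakpoints by (auto simp: space_support_space)
      fix j assume j: "j \<in> {1..p e}"
      note c = feas[OF s k, THEN conjunct2, rule_format, OF e j]
      show "\<bar>\<zeta> s k e j\<bar> \<le> lam" using c by blast
      show "d k e \<bullet> lift_G_left (p e) (w e) (w e j) - \<zeta> s k e j * (w e j - \<xi>hat s e) \<le> \<eta>b s k e"
        "d k e \<bullet> lift_G (p e) (w e) (w e (j - 1)) - \<zeta> s k e j * (w e (j - 1) - \<xi>hat s e)
          \<le> \<eta>b s k e"
        using c unfolding retract_at_breakpoints[OF e j] by blast+
    qed
    then have "(\<Sum>e\<in>E. block_cost k e (\<xi> e) - lam * \<bar>\<xi> e - \<xi>hat s e\<bar>) \<le> (\<Sum>e\<in>E. \<eta>b s k e)"
      by (rule sum_mono)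
    also have "\<dots> = (\<Sum>t\<in>{1..T}. \<Sum>i\<in>{1..n}. \<eta>b s k (t, i))"
      by (simp add: disturbance_idx_def sum.cartesian_product)
    also have "\<dots> \<le> \<eta> s - r k"
      using feas[OF s k, THEN conjunct1] by linarith
    finally show ?thesis
      using penalized_sum[of k \<xi> lam "\<xi>hat s"] by linarith
  qed
  then have "cost \<xi> \<le> \<eta> s + lam * dist1 E \<xi> (\<xi>hat s)"
    unfolding cost_le_iff by blast
  then show "cost \<xi> - lam * dist1 E \<xi> (\<xi>hat s) \<le> \<eta> s" by linarith
qed

text \<open>Conversely, for given \<open>lam\<close> the componentwise suprema are a feasible choice of the block
  variables, and \<open>\<eta> s\<close> need not be larger than the supremum of the penalized cost itself, since the
  components of \<open>\<xi>\<close> vary independently over the hyperrectangle.\<close>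

lemma exists_feasible_at_pointwise_supremum:
  assumes lam: "0 \<le> lam"
  obtains \<eta>b \<zeta> where "reformulation_feasible T n N K p w \<xi>hat d r lam
      (\<lambda>s. SUP \<xi>\<in>space \<Xi>. cost \<xi> - lam * dist1 E \<xi> (\<xi>hat s)) \<eta>b \<zeta>"
proof -
  define \<eta> where "\<eta> s = (SUP \<xi>\<in>space \<Xi>. cost \<xi> - lam * dist1 E \<xi> (\<xi>hat s))" for s
  define \<eta>b where "\<eta>b s k e = (SUP x\<in>{l e..v e}. block_cost k e x - lam * \<bar>x - \<xi>hat s e\<bar>)" for s k e
  have \<eta>b: "block_cost k e x - lam * \<bar>x - \<xi>hat s e\<bar> \<le> \<eta>b s k e"
    if e: "e \<in> E" and x: "x \<in> {w e 0..w e (p e)}" for s k e x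
  proof -
    obtain B where "\<forall>x\<in>{l e..v e}. \<bar>block_cost k e x\<bar> \<le> B"
      using breakpoint_grid.lift_G_bounded[OF grid[OF e]] by blast
    then have "\<bar>block_cost k e x\<bar> \<le> B" if "x \<in> {l e..v e}" for x using that by blast
    then have "block_cost k e x - lam * \<bar>x - \<xi>hat s e\<bar> \<le> B" if "x \<in> {l e..v e}" for x
      using abs_le_D1[of "block_cost k e x" B] that
        mult_nonneg_nonneg[OF lam abs_ge_zero[of "x - \<xi>hat s e"]] by force
    then have "bdd_above ((\<lambda>x. block_cost k e x - lam * \<bar>x - \<xi>hat s e\<bar>) ` {l e..v e})"
      by (rule bdd_aboveI2)
    moreover have "x \<in> {l e..v e}" using x breakpoints(1,2)[OF e] by simp
    ultimately show ?thesis unfolding \<eta>b_def by (rule cSUP_upper[rotated])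
  qed
  have "\<exists>z. \<bar>z\<bar> \<le> lam \<and> d k e \<bullet> lift_G_left (p e) (w e) (w e j) - z * (w e j - \<xi>hat s e) \<le> \<eta>b s k e
    \<and> d k e \<bullet> lift_G (p e) (w e) (w e (j - 1)) - z * (w e (j - 1) - \<xi>hat s e) \<le> \<eta>b s k e"
    if "e \<in> E" "j \<in> {1..p e}" for s k e j
    using that by (intro breakpoint_grid.exists_piece_multiplier[OF grid] lam \<eta>b)
  note ex = this
  define \<zeta> where "\<zeta> s k e j = (SOME z. \<bar>z\<bar> \<le> lam
    \<and> d k e \<bullet> lift_G_left (p e) (w e) (w e j) - z * (w e j - \<xi>hat s e) \<le> \<eta>b s k e
    \<and> d k e \<bullet> lift_G (p e) (w e) (w e (j - 1)) - z * (w e (j - 1) - \<xi>hat s e) \<le> \<eta>b s k e)"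
    for s k e j
  have \<zeta>: "\<bar>\<zeta> s k e j\<bar> \<le> lam
    \<and> d k e \<bullet> lift_G_left (p e) (w e) (w e j) - \<zeta> s k e j * (w e j - \<xi>hat s e) \<le> \<eta>b s k e
    \<and> d k e \<bullet> lift_G (p e) (w e) (w e (j - 1)) - \<zeta> s k e j * (w e (j - 1) - \<xi>hat s e)
      \<le> \<eta>b s k e"
    if "e \<in> E" "j \<in> {1..p e}" for s k e j
    unfolding \<zeta>_def by (rule someI_ex[OF ex[OF that]])
  have "(\<Sum>t\<in>{1..T}. \<Sum>i\<in>{1..n}. \<eta>b s k (t, i)) + r k \<le> \<eta> s"
    if s: "s \<in> {1..N}" and k: "k \<in> {1..K}" for s k
  proof -
    have "(\<Sum>e\<in>E. \<eta>b s k e) \<le> \<eta> s - r k"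
      unfolding \<eta>b_def
    proof (rule sum_SUP_le[OF finite_E])
      fix e assume e: "e \<in> E"
      then show "{l e..v e} \<noteq> {}" using data[OF s] by (force simp: space_support_space)
    next
      fix \<xi> assume "\<xi> \<in> (\<Pi>\<^sub>E e\<in>E. {l e..v e})"
      then have "cost \<xi> - lam * dist1 E \<xi> (\<xi>hat s) \<le> \<eta> s"
        unfolding \<eta>_def by (intro transport.SUP_dual_bound[OF lam]) (simp add: space_support_space)
      then show "(\<Sum>e\<in>E. block_cost k e (\<xi> e) - lam * \<bar>\<xi> e - \<xi>hat s e\<bar>) \<le> \<eta> s - r k"
        using piece_le_cost[OF k, of \<xi>] penalized_sum[of k \<xi> lam "\<xi>hat s"] by linarith
    qed
    then show ?thesis
      by (simp add: disturbance_idx_def sum.cartesian_product)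
  qed
  then have "reformulation_feasible T n N K p w \<xi>hat d r lam \<eta> \<eta>b \<zeta>"
    unfolding reformulation_feasible_def
    using \<zeta> by (auto simp only: retract_at_breakpoints intro!: ballI conjI)
  then show ?thesis using that unfolding \<eta>_def by blast
qed

lemma objective_eq: "reformulation_objective N \<theta> lam \<eta> = lam * \<theta> + transport.avg \<eta>"
  by (simp add: reformulation_objective_def transport.avg_def)

lemma worst_case_le_objective:
  assumes "0 \<le> \<theta>" "reformulation_feasible T n N K p w \<xi>hat d r lam \<eta> \<eta>b \<zeta>"
  shows "(SUP P\<in>transport.W_ball \<theta>. ereal (\<integral>\<xi>. cost \<xi> \<partial>P))
    \<le> ereal (reformulation_objective N \<theta> lam \<eta>)"
  unfolding objective_eq
  using feasible_dominates[OF assms(2)] assms(1)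
  by (intro SUP_least) (auto intro!: transport.integral_le_dual)

lemma worst_case_attained:
  assumes "0 < \<theta>"
  shows "\<exists>lam \<eta> \<eta>b \<zeta>. reformulation_feasible T n N K p w \<xi>hat d r lam \<eta> \<eta>b \<zeta> \<and>
    (SUP P\<in>transport.W_ball \<theta>. ereal (\<integral>\<xi>. cost \<xi> \<partial>P))
      = ereal (reformulation_objective N \<theta> lam \<eta>)"
proof -
  obtain lam where lam: "0 \<le> lam" "(SUP P\<in>transport.W_ball \<theta>. ereal (\<integral>\<xi>. cost \<xi> \<partial>P))
      = ereal (lam * \<theta> + transport.avg (\<lambda>s. SUP \<xi>\<in>space \<Xi>. cost \<xi> - lam * dist1 E \<xi> (\<xi>hat s)))"
    by (rule transport.strong_duality[OF assms])
  moreover obtain \<eta>b \<zeta> where "reformulation_feasible T n N K p w \<xi>hat d r lam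
      (\<lambda>s. SUP \<xi>\<in>space \<Xi>. cost \<xi> - lam * dist1 E \<xi> (\<xi>hat s)) \<eta>b \<zeta>"
    by (rule exists_feasible_at_pointwise_supremum[OF lam(1)])
  ultimately show ?thesis unfolding objective_eq by blast
qed

end

section \<open>Optimizing over the policies\<close>

theorem theorem3:
  fixes T n N K :: nat
    and l v :: "nat \<times> nat \<Rightarrow> real"
    and p :: "nat \<times> nat \<Rightarrow> nat"
    and w :: "nat \<times> nat \<Rightarrow> nat \<Rightarrow> real"
    and \<xi>hat :: "nat \<Rightarrow> nat \<times> nat \<Rightarrow> real"
    and \<theta> :: real
    and S :: control_problem
    and d :: "policy \<Rightarrow> nat \<Rightarrow> nat \<times> nat \<Rightarrow> real vec"
    and r :: "policy \<Rightarrow> nat \<Rightarrow> real"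
  defines "E \<equiv> disturbance_idx T n"
  defines "\<Xi> \<equiv> support_space E l v"
  defines "Pol \<equiv> policies T n p S"
  defines "\<B> \<equiv> wasserstein_ball \<Xi> (dist1 E) (empirical \<Xi> N \<xi>hat) \<theta>"
  defines "cost \<equiv> \<lambda>\<pi> \<xi>. MAX k\<in>{1..K}. stack T n (d \<pi> k) \<bullet> lift_all T n p w \<xi> + r \<pi> k"
  defines "worst_case \<equiv> \<lambda>\<pi>. SUP P\<in>\<B>. ereal (\<integral>\<xi>. cost \<pi> \<xi> \<partial>P)"
  assumes "1 \<le> T" "1 \<le> n" "1 \<le> N" "1 \<le> K"
    and radius: "0 < \<theta>"
    and data: "\<And>s. s \<in> {1..N} \<Longrightarrow> \<xi>hat s \<in> space \<Xi>"
    and pieces: "\<And>e. e \<in> E \<Longrightarrow> 1 \<le> p e"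
    and breakpoints: "\<And>e. e \<in> E \<Longrightarrow> w e 0 = l e"
      "\<And>e. e \<in> E \<Longrightarrow> w e (p e) = v e"
      "\<And>e j. e \<in> E \<Longrightarrow> j \<in> {1..p e} \<Longrightarrow> w e (j - 1) \<le> w e j"
    and problem: "control_problem_ok T n S"
    and d_dim: "\<And>\<pi> k e. \<pi> \<in> Pol \<Longrightarrow> k \<in> {1..K} \<Longrightarrow> e \<in> E \<Longrightarrow>
      d \<pi> k e \<in> carrier_vec (p e + (p e - 1))"
    and d_affine: "\<And>k e m. k \<in> {1..K} \<Longrightarrow> e \<in> E \<Longrightarrow> m < p e + (p e - 1) \<Longrightarrow>
      policy_affine T n p S (\<lambda>\<pi>. d \<pi> k e $ m)"
    and r_affine: "\<And>k. k \<in> {1..K} \<Longrightarrow> policy_affine T n p S (\<lambda>\<pi>. r \<pi> k)"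
    and cost_repr: "\<And>\<pi> \<xi>. \<pi> \<in> Pol \<Longrightarrow> \<xi> \<in> space \<Xi> \<Longrightarrow>
      total_cost T n p w S \<pi> \<xi> = cost \<pi> \<xi>"
  shows "(\<forall>\<pi>\<in>Pol.
            (\<exists>lam \<eta> \<eta>b \<zeta>. reformulation_feasible T n N K p w \<xi>hat (d \<pi>) (r \<pi>) lam \<eta> \<eta>b \<zeta> \<and>
               worst_case \<pi> = ereal (reformulation_objective N \<theta> lam \<eta>)) \<and>
            (\<forall>lam \<eta> \<eta>b \<zeta>. reformulation_feasible T n N K p w \<xi>hat (d \<pi>) (r \<pi>) lam \<eta> \<eta>b \<zeta> \<longrightarrow>
               worst_case \<pi> \<le> ereal (reformulation_objective N \<theta> lam \<eta>))) \<and>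
         (INF \<pi>\<in>Pol. worst_case \<pi>) =
           Inf {ereal (reformulation_objective N \<theta> lam \<eta>) | \<pi> lam \<eta> \<eta>b \<zeta>.
             \<pi> \<in> Pol \<and> reformulation_feasible T n N K p w \<xi>hat (d \<pi>) (r \<pi>) lam \<eta> \<eta>b \<zeta>}"
proof -
  have "lifted_objective T n N K l v p w \<xi>hat (d \<pi>)" if "\<pi> \<in> Pol" for \<pi>
    using assms(7-10) data pieces breakpoints d_dim[OF that]
    unfolding E_def \<Xi>_def by unfold_locales
  note lo = this
  have cost: "cost \<pi> = lifted_objective.cost T n K p w (d \<pi>) (r \<pi>)" if "\<pi> \<in> Pol" for \<pi>
    unfolding cost_def lifted_objective.cost_def[OF lo[OF that]] ..
  have attained: "\<exists>lam \<eta> \<eta>b \<zeta>. reformulation_feasible T n N K p w \<xi>hat (d \<pi>) (r \<pi>) lam \<eta> \<eta>b \<zeta> \<and>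
      worst_case \<pi> = ereal (reformulation_objective N \<theta> lam \<eta>)" if "\<pi> \<in> Pol" for \<pi>
    using lifted_objective.worst_case_attained[OF lo[OF that] radius]
    unfolding worst_case_def \<B>_def \<Xi>_def E_def cost[OF that] .
  have lower: "worst_case \<pi> \<le> ereal (reformulation_objective N \<theta> lam \<eta>)"
    if "\<pi> \<in> Pol" "reformulation_feasible T n N K p w \<xi>hat (d \<pi>) (r \<pi>) lam \<eta> \<eta>b \<zeta>" for \<pi> lam \<eta> \<eta>b \<zeta>
    using lifted_objective.worst_case_le_objective[OF lo[OF that(1)] less_imp_le[OF radius] that(2)]
    unfolding worst_case_def \<B>_def \<Xi>_def E_def cost[OF that(1)] .
  let ?V = "{ereal (reformulation_objective N \<theta> lam \<eta>) | \<pi> lam \<eta> \<eta>b \<zeta>.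
    \<pi> \<in> Pol \<and> reformulation_feasible T n N K p w \<xi>hat (d \<pi>) (r \<pi>) lam \<eta> \<eta>b \<zeta>}"
  have "(INF \<pi>\<in>Pol. worst_case \<pi>) = Inf ?V"
  proof (rule antisym)
    show "(INF \<pi>\<in>Pol. worst_case \<pi>) \<le> Inf ?V"
      by (rule Inf_greatest) (blast intro: INF_lower2 lower)
    show "Inf ?V \<le> (INF \<pi>\<in>Pol. worst_case \<pi>)"
    proof (rule INF_greatest)
      fix \<pi> assume "\<pi> \<in> Pol"
      then have "worst_case \<pi> \<in> ?V" using attained by blast
      then show "Inf ?V \<le> worst_case \<pi>" by (rule Inf_lower)
    qed
  qed
  then show ?thesis using attained lower by blast
qed

end
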